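(* Let $G$ be a probability distribution on $[0,\infty)$, let $\boldsymbol X=(X_0,X_1,\dots)$ be a homogeneous Markov chain on $[0,\infty)$ with transition kernel $K\in D(G)$, and let $y(t)$ be a uniform extremal boundary for $K$. Let $\boldsymbol T=(T_0,T_1,\dots)$ be a Markov chain on $[0,\infty)$ whose transition kernel is a tail kernel associated with $G$ with arbitrary boundary distribution $H$. For $m\ge1$ put $\mathbb E'_m=(0,\infty]^{m-1}\times[0,\infty]$ and $\mathbb E'_m(t)=(y(t),\infty]^{m-1}\times[0,\infty]$, and define the measures on $[0,\infty]^m$ $$\widetilde\mu^{(t)}_m(u,\cdot)=\mathsf P_{tu}\Big[\Big(\tfrac{X_1}{t},\dots,\tfrac{X_m}{t}\Big)\in\cdot\,\cap\mathbb E'_m(t)\Big],\qquad \mu_m(u,\cdot)=\mathsf P_u\big[(T_1,\dots,T_m)\in\cdot\,\cap\mathbb E'_m\big].$$ If $u_t=u(t)$ is a non-negative function with $u_t\to u>0$ as $t\to\infty$, then $$\widetilde\mu^{(t)}_m(u_t,\cdot)\stackrel{v}{\longrightarrow}\mu_m(u,\cdot)\quad\text{in }\mathbb M_+([0,\infty]^m)\qquad(t\to\infty).$$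
   Context: A Markov transition kernel $K:[0,\infty)\times\mathcal B[0,\infty)\to[0,1]$ is in the domain of attraction of $G$, written $K\in D(G)$, if $K(t,t\,\cdot)\Rightarrow G(\cdot)$ on $[0,\infty]$ as $t\to\infty$ (weak convergence; $tA=\{ta:a\in A\}$). The tail kernel associated with $G$, with boundary distribution $H$ (a probability distribution on $[0,\infty)$), is $K^*(y,A)=G(y^{-1}A)$ for $y>0$ and $K^*(0,A)=H(A)$. An extremal boundary for $K\in D(G)$ is a non-negative function $y(t)$ on $[0,\infty)$ with $\lim_{t\to\infty}y(t)=0$ and $K(t,t[0,y(t)])\to G(\{0\})$ as $t\to\infty$; it is a uniform extremal boundary if moreover $K(tu_t,t[0,y(t)])\to G(\{0\})$ for every non-negative function $u_t\to u>0$. $\mathsf P_x$ denotes conditional probability given that the initial state is $x$. $\mathbb M_+(\mathbb E)$ is the space of non-negative Radon measures on $\mathbb E$; $\mu_t\stackrel{v}{\to}\mu$ means $\int f\,d\mu_t\to\int f\,d\mu$ for all non-negative continuous $f$ with compact support in $\mathbb E$. *)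

theory Defs
  imports "HOL-Probability.Probability"
begin

text \<open>
  The state space \<open>[0,\<infinity>)\<close> is a subspace of the reals; its compactification \<open>[0,\<infinity>]\<close> is the
  (compact) type \<^typ>\<open>ennreal\<close>, and \<^const>\<open>ennreal\<close> is the inclusion map.
\<close>

abbreviation halfline :: "real measure" where
  "halfline \<equiv> restrict_space borel {0..}"

definition prob_on :: "'s measure \<Rightarrow> 's measure \<Rightarrow> bool" where
  "prob_on S G \<longleftrightarrow> prob_space G \<and> sets G = sets S"

abbreviation markov_kernel :: "'s measure \<Rightarrow> ('s \<Rightarrow> 's measure) \<Rightarrow> bool" where
  "markov_kernel S K \<equiv> K \<in> S \<rightarrow>\<^sub>M prob_algebra S"


subsection \<open>Weak and vague convergence\<close>

definition weak_conv_in ::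
    "'a topology \<Rightarrow> ('i \<Rightarrow> 'a measure) \<Rightarrow> 'a measure \<Rightarrow> 'i filter \<Rightarrow> bool" where
  "weak_conv_in X \<mu> \<nu> F \<longleftrightarrow>
     (\<forall>f :: 'a \<Rightarrow> real. continuous_map X euclidean f \<longrightarrow> bounded (f ` topspace X) \<longrightarrow>
        ((\<lambda>t. \<integral>x. f x \<partial>\<mu> t) \<longlongrightarrow> (\<integral>x. f x \<partial>\<nu>)) F)"

definition vague_conv_in ::
    "'a topology \<Rightarrow> ('i \<Rightarrow> 'a measure) \<Rightarrow> 'a measure \<Rightarrow> 'i filter \<Rightarrow> bool" where
  "vague_conv_in X \<mu> \<nu> F \<longleftrightarrow>
     (\<forall>f :: 'a \<Rightarrow> real. continuous_map X euclidean f \<longrightarrow> (\<forall>x \<in> topspace X. 0 \<le> f x) \<longrightarrow>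
        compactin X (X closure_of {x \<in> topspace X. f x \<noteq> 0}) \<longrightarrow>
        ((\<lambda>t. \<integral>x. f x \<partial>\<mu> t) \<longlongrightarrow> (\<integral>x. f x \<partial>\<nu>)) F)"


subsection \<open>Domain of attraction, tail kernel, extremal boundary\<close>

text \<open>\<open>K(t, t \<cdot>)\<close> is the image of \<open>K(t, \<cdot>)\<close> under \<open>x \<mapsto> x / t\<close>, here regarded as a measure on \<open>[0,\<infinity>]\<close>.\<close>

definition in_domain_of_attraction ::
    "(real \<Rightarrow> real measure) \<Rightarrow> real measure \<Rightarrow> bool" where
  "in_domain_of_attraction K G \<longleftrightarrow>
     weak_conv_in euclidean
       (\<lambda>t. distr (K t) borel (\<lambda>x. ennreal (x / t))) (distr G borel ennreal) at_top"

text \<open>\<open>G(y\<^sup>-\<^sup>1 A) = G {x. y * x \<in> A}\<close>, so \<open>K\<^sup>*(y, \<cdot>)\<close> is the image of \<open>G\<close> under \<open>x \<mapsto> y * x\<close>.\<close>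

definition tail_kernel :: "real measure \<Rightarrow> real measure \<Rightarrow> real \<Rightarrow> real measure" where
  "tail_kernel G H y = (if y = 0 then H else distr G halfline (\<lambda>x. y * x))"

definition extremal_boundary ::
    "(real \<Rightarrow> real measure) \<Rightarrow> real measure \<Rightarrow> (real \<Rightarrow> real) \<Rightarrow> bool" where
  "extremal_boundary K G y \<longleftrightarrow>
     (\<forall>t\<ge>0. 0 \<le> y t) \<and> (y \<longlongrightarrow> 0) at_top \<and>
     ((\<lambda>t. measure (K t) ((*) t ` {0..y t})) \<longlongrightarrow> measure G {0}) at_top"

definition uniform_extremal_boundary ::
    "(real \<Rightarrow> real measure) \<Rightarrow> real measure \<Rightarrow> (real \<Rightarrow> real) \<Rightarrow> bool" where
  "uniform_extremal_boundary K G y \<longleftrightarrow>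
     extremal_boundary K G y \<and>
     (\<forall>u u0. (\<forall>t\<ge>0. 0 \<le> u t) \<longrightarrow> (u \<longlongrightarrow> u0) at_top \<longrightarrow> 0 < u0 \<longrightarrow>
        ((\<lambda>t. measure (K (t * u t)) ((*) t ` {0..y t})) \<longlongrightarrow> measure G {0}) at_top)"


subsection \<open>Markov chains\<close>

definition history :: "'s measure \<Rightarrow> 'w measure \<Rightarrow> (nat \<Rightarrow> 'w \<Rightarrow> 's) \<Rightarrow> nat \<Rightarrow> 'w measure" where
  "history S M X n =
     vimage_algebra (space M) (\<lambda>w. \<lambda>i\<in>{..n}. X i w) (\<Pi>\<^sub>M i\<in>{..n}. S)"

definition markov_chain ::
    "'s measure \<Rightarrow> ('s \<Rightarrow> 's measure) \<Rightarrow> 'w measure \<Rightarrow> (nat \<Rightarrow> 'w \<Rightarrow> 's) \<Rightarrow> bool" where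
  "markov_chain S K M X \<longleftrightarrow>
     prob_space M \<and> (\<forall>n. X n \<in> M \<rightarrow>\<^sub>M S) \<and>
     (\<forall>n. \<forall>A \<in> sets S. AE w in M.
        real_cond_exp M (history S M X n) (indicator {w \<in> space M. X (Suc n) w \<in> A}) w
          = measure (K (X n w)) A)"

text \<open>
  The conditional probabilities \<open>P x\<close> given the initial state \<open>x\<close>, needed for every single \<open>x\<close>
  and not merely for almost every one, are rendered as usual by a family of laws: under
  \<open>P x\<close> the process is a Markov chain with kernel \<open>K\<close> started at \<open>x\<close>.
\<close>

definition markov_family ::
    "'s measure \<Rightarrow> ('s \<Rightarrow> 's measure) \<Rightarrow> ('s \<Rightarrow> 'w measure) \<Rightarrow> (nat \<Rightarrow> 'w \<Rightarrow> 's) \<Rightarrow> bool" where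
  "markov_family S K P X \<longleftrightarrow>
     (\<forall>x \<in> space S. markov_chain S K (P x) X \<and> (AE w in P x. X 0 w = x))"


subsection \<open>The measures on the cube\<close>

text \<open>Points of \<open>[0,\<infinity>]\<^sup>m\<close> are extensional functions on the index set \<open>{1..m}\<close>.\<close>

abbreviation cube_topology :: "nat \<Rightarrow> (nat \<Rightarrow> ennreal) topology" where
  "cube_topology m \<equiv> product_topology (\<lambda>_. euclidean) {1..m}"

abbreviation cube_borel :: "nat \<Rightarrow> (nat \<Rightarrow> ennreal) measure" where
  "cube_borel m \<equiv> (\<Pi>\<^sub>M i\<in>{1..m}. borel)"

text \<open>\<open>E' m c = (c,\<infinity>]\<^sup>m\<^sup>-\<^sup>1 \<times> [0,\<infinity>]\<close>\<close>

definition E' :: "nat \<Rightarrow> real \<Rightarrow> (nat \<Rightarrow> ennreal) set" where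
  "E' m c = (\<Pi>\<^sub>E i\<in>{1..m}. if i < m then {ennreal c<..} else UNIV)"

text \<open>The measure \<open>A \<mapsto> M {w. V w \<in> A \<inter> E}\<close>, see \<open>emeasure_law_on\<close> below.\<close>

definition law_on :: "'w measure \<Rightarrow> 'a measure \<Rightarrow> ('w \<Rightarrow> 'a) \<Rightarrow> 'a set \<Rightarrow> 'a measure" where
  "law_on M N V E = density (distr M N V) (indicator E)"

lemma emeasure_law_on:
  assumes "V \<in> M \<rightarrow>\<^sub>M N" "E \<in> sets N" "A \<in> sets N"
  shows "emeasure (law_on M N V E) A = emeasure M {w \<in> space M. V w \<in> A \<inter> E}"
proof -
  have "emeasure (law_on M N V E) A = emeasure (distr M N V) (E \<inter> A)"
    using assms by (simp add: law_on_def emeasure_density nn_integral_indicator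
        flip: indicator_inter_arith)
  also have "\<dots> = emeasure M (V -` (E \<inter> A) \<inter> space M)"
    using assms by (intro emeasure_distr) auto
  also have "V -` (E \<inter> A) \<inter> space M = {w \<in> space M. V w \<in> A \<inter> E}"
    by auto
  finally show ?thesis .
qed

lemma sets_E': "E' m c \<in> sets (cube_borel m)"
  unfolding E'_def by (intro sets_PiM_I_finite) auto

definition mu_tilde ::
    "(real \<Rightarrow> 'w measure) \<Rightarrow> (nat \<Rightarrow> 'w \<Rightarrow> real) \<Rightarrow> (real \<Rightarrow> real) \<Rightarrow> nat \<Rightarrow> real \<Rightarrow> real \<Rightarrow>
      (nat \<Rightarrow> ennreal) measure" where
  "mu_tilde P X y m t u =
     law_on (P (t * u)) (cube_borel m) (\<lambda>w. \<lambda>i\<in>{1..m}. ennreal (X i w / t)) (E' m (y t))"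

definition mu ::
    "(real \<Rightarrow> 'w measure) \<Rightarrow> (nat \<Rightarrow> 'w \<Rightarrow> real) \<Rightarrow> nat \<Rightarrow> real \<Rightarrow> (nat \<Rightarrow> ennreal) measure" where
  "mu P T m u =
     law_on (P u) (cube_borel m) (\<lambda>w. \<lambda>i\<in>{1..m}. ennreal (T i w)) (E' m 0)"

end

theory Submission imports Defs begin

text \<open>
  By the Markov property both sides are \<open>m\<close>-fold iterated integrals, and the proof shows by
  backward induction that the inner integrals, as functions of the states already visited, converge
  continuously at all points with positive coordinates. The induction step represents the weakly
  convergent rescaled transition laws by almost surely convergent variables (Skorohod), so that
  dominated convergence applies wherever the limit is positive. Near \<open>0\<close>, where continuous
  convergence breaks down, the integrands vanish below the boundary \<open>y(t)\<close>, and the uniform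
  extremal boundary property says that the mass above \<open>y(t)\<close> tending to \<open>0\<close> is negligible.
\<close>

subsection \<open>Markov chains and iterated expectations\<close>

text \<open>The hypothesis \<open>K\<close> in \<open>D(G)\<close> controls \<open>K(r, r .)\<close>
  only along the diagonal. A start \<open>r = s * x\<close> with \<open>x\<close> tending to
  \<open>x0 > 0\<close> still goes to infinity with \<open>s\<close>, and rescaling the diagonal
  limit by \<open>x\<close> gives the law of \<open>x0\<close> times a \<open>G\<close>-variable,
  which is the tail kernel at \<open>x0\<close>. If \<open>x0 = 0\<close>, then \<open>r\<close>
  need not tend to infinity and this argument says nothing, so every state from which a further
  transition is taken must have a positive limit. The indicator of \<open>E'\<close> enforces this:
  the integrand vanishes as soon as one of the coordinates \<open>1, ..., m - 1\<close> is at or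
  below the threshold, which is also why an arbitrary law \<open>H\<close> at \<open>0\<close> is
  admissible. Coordinate \<open>m\<close> is not cut: no transition starts there, and the test
  function is continuous at \<open>0\<close>.

  Skorohod's theorem concerns sequences, so limits in \<open>t\<close> are tested along sequences;
  the uniform boundary property is about functions of \<open>t\<close> and has to be carried over to
  sequences separately.\<close>

lemma (in prob_space) abs_integral_le_bound:
  fixes h :: "'a \<Rightarrow> real"
  assumes "\<And>v. v \<in> space M \<Longrightarrow> \<bar>h v\<bar> \<le> C" "0 \<le> C"
  shows "\<bar>\<integral>v. h v \<partial>M\<bar> \<le> C"
\<comment> \<open>The Bochner integral of a non-integrable function is 0, so the bound holds without
  any measurability of \<open>h\<close>.\<close>
proof (cases "integrable M h")
  case True
  have "\<bar>\<integral>v. h v \<partial>M\<bar> \<le> (\<integral>v. \<bar>h v\<bar> \<partial>M)"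
    by (rule integral_abs_bound)
  also have "\<dots> \<le> C"
    using True assms(1) by (intro integral_le_const) (auto intro!: AE_I2)
  finally show ?thesis .
qed (simp add: not_integrable_integral_eq assms(2))

text \<open>The indicator of a history event is measurable for the history algebra, so it can be
  moved inside the conditional expectation, which the Markov property then replaces by the kernel.
  This yields the joint law of history and next state on rectangles.\<close>

lemma markov_chain_step_measure:
  assumes X: "markov_chain S K M X"
    and K: "K \<in> S \<rightarrow>\<^sub>M prob_algebra S"
    and A: "A \<in> sets (\<Pi>\<^sub>M i\<in>{..n}. S)" and B: "B \<in> sets S"
  shows "emeasure M {w \<in> space M. (\<lambda>i\<in>{..n}. X i w) \<in> A \<and> X (Suc n) w \<in> B} =
    (\<integral>\<^sup>+w. indicator A (\<lambda>i\<in>{..n}. X i w) * emeasure (K (X n w)) B \<partial>M)"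
proof -
  interpret prob_space M using X by (simp add: markov_chain_def)
  have Xm [measurable]: "X i \<in> M \<rightarrow>\<^sub>M S" for i using X by (simp add: markov_chain_def)
  note [measurable] = A B
  define h where "h = (\<lambda>w. \<lambda>i\<in>{..n}. X i w)"
  have h [measurable]: "h \<in> M \<rightarrow>\<^sub>M (\<Pi>\<^sub>M i\<in>{..n}. S)"
    unfolding h_def by measurable
  define F where "F = history S M X n"
  have F_eq: "F = vimage_algebra (space M) h (\<Pi>\<^sub>M i\<in>{..n}. S)"
    by (simp add: F_def history_def h_def)
  have hs: "h \<in> space M \<rightarrow> space (\<Pi>\<^sub>M i\<in>{..n}. S)" using measurable_space[OF h] by auto
  have sub: "subalgebra M F"
    unfolding subalgebra_def F_eq using hs by (auto simp: sets_vimage_algebra2)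
  interpret finite_measure_subalgebra M F
    by unfold_locales (rule sub)
  have hF [measurable]: "h \<in> F \<rightarrow>\<^sub>M (\<Pi>\<^sub>M i\<in>{..n}. S)"
    unfolding F_eq using hs by (rule measurable_vimage_algebra1)
  define b where "b = (indicator {w \<in> space M. X (Suc n) w \<in> B} :: _ \<Rightarrow> real)"
  have [measurable]: "b \<in> borel_measurable M" unfolding b_def by measurable
  have ce: "AE w in M. real_cond_exp M F b w = measure (K (X n w)) B"
    using X B unfolding markov_chain_def F_def b_def by auto
  have Kp: "prob_space (K x)" "sets (K x) = sets S" if "x \<in> space S" for x
    using measurable_space[OF K that] by (auto simp: space_prob_algebra)
  have [measurable]: "(\<lambda>w. measure (K (X n w)) B) \<in> borel_measurable M"
    using measurable_prob_algebraD[OF K] by measurable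
  have int: "integrable M (\<lambda>w. indicator A (h w) * measure (K (X n w)) B)"
    by (rule integrable_const_bound[of _ 1])
      (auto intro!: AE_I2 prob_space.prob_le_1 Kp measurable_space[of "X n"] simp: indicator_def)
  have "measure M {w \<in> space M. h w \<in> A \<and> X (Suc n) w \<in> B} = (\<integral>w. indicator {w \<in> space M. h w \<in> A \<and> X (Suc n) w \<in> B} w \<partial>M)"
    by simp
  also have "\<dots> = (\<integral>w. indicator A (h w) * b w \<partial>M)"
    by (intro Bochner_Integration.integral_cong) (auto simp: b_def indicator_def)
  also have "\<dots> = (\<integral>w. indicator A (h w) * real_cond_exp M F b w \<partial>M)"
    by (intro real_cond_exp_intg(2)[symmetric])
      (auto intro!: integrable_const_bound[of _ 1] simp: b_def indicator_def)
  also have "\<dots> = (\<integral>w. indicator A (h w) * measure (K (X n w)) B \<partial>M)"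
    using ce by (intro integral_cong_AE) (auto simp: b_def)
  finally have "emeasure M {w \<in> space M. h w \<in> A \<and> X (Suc n) w \<in> B} = ennreal (\<integral>w. indicator A (h w) * measure (K (X n w)) B \<partial>M)"
    by (simp add: emeasure_eq_measure)
  also have "\<dots> = (\<integral>\<^sup>+w. ennreal (indicator A (h w) * measure (K (X n w)) B) \<partial>M)"
    by (intro nn_integral_eq_integral[symmetric] int) auto
  also have "\<dots> = (\<integral>\<^sup>+w. indicator A (h w) * emeasure (K (X n w)) B \<partial>M)"
  proof (intro nn_integral_cong)
    fix w assume "w \<in> space M"
    then have "X n w \<in> space S" by (rule measurable_space[OF Xm])
    then interpret Kx: prob_space "K (X n w)" by (rule Kp)
    show "ennreal (indicator A (h w) * measure (K (X n w)) B) = indicator A (h w) * emeasure (K (X n w)) B"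
      by (auto simp: Kx.emeasure_eq_measure indicator_def)
  qed
  finally show ?thesis by (simp add: h_def)
qed

text \<open>The joint law of history and next state is the semidirect product of the law of the
  history with the kernel; integrating \<open>F\<close> against it gives the iterated
  integral.\<close>

lemma markov_chain_step:
  fixes F :: "(nat \<Rightarrow> 's) \<times> 's \<Rightarrow> real"
  assumes X: "markov_chain S K M X"
    and K: "K \<in> S \<rightarrow>\<^sub>M prob_algebra S"
    and F: "F \<in> borel_measurable ((\<Pi>\<^sub>M i\<in>{..n}. S) \<Otimes>\<^sub>M S)"
    and C: "\<And>p. p \<in> space ((\<Pi>\<^sub>M i\<in>{..n}. S) \<Otimes>\<^sub>M S) \<Longrightarrow> \<bar>F p\<bar> \<le> C"
  shows "(\<integral>w. F (\<lambda>i\<in>{..n}. X i w, X (Suc n) w) \<partial>M) =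
    (\<integral>w. (\<integral>v. F (\<lambda>i\<in>{..n}. X i w, v) \<partial>K (X n w)) \<partial>M)"
proof -
  interpret prob_space M using X by (simp add: markov_chain_def)
  have Xm [measurable]: "X i \<in> M \<rightarrow>\<^sub>M S" for i using X by (simp add: markov_chain_def)
  note [measurable] = F
  define h where "h = (\<lambda>w. \<lambda>i\<in>{..n}. X i w)"
  define R where "R = (\<Pi>\<^sub>M i\<in>{..n}. S)"
  \<comment> \<open>\<open>L x\<close> is the product of the Dirac measure at the history
    \<open>x\<close> with \<open>K (x n)\<close>, so that \<open>D \<bind> L\<close> is the
    semidirect product.\<close>
  define L where "L = (\<lambda>x. distr (K (x n)) (R \<Otimes>\<^sub>M S) (Pair x))"
  define D where "D = distr M R h"
  have F' [measurable]: "F \<in> borel_measurable (R \<Otimes>\<^sub>M S)" using F by (simp add: R_def)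
  have h [measurable]: "h \<in> M \<rightarrow>\<^sub>M R"
    unfolding h_def R_def by measurable
  have proj: "(\<lambda>x. x n) \<in> R \<rightarrow>\<^sub>M S" unfolding R_def by measurable
  have Kp: "prob_space (K x)" "sets (K x) = sets S" if "x \<in> space S" for x
    using measurable_space[OF K that] by (auto simp: space_prob_algebra)
  have XS: "X i w \<in> space S" if "w \<in> space M" for i w
    using that by (rule measurable_space[OF Xm])
  have hR: "h w \<in> space R" if "w \<in> space M" for w
    using that measurable_space[OF h] by auto
  have Pm: "Pair (h w) \<in> K (X n w) \<rightarrow>\<^sub>M R \<Otimes>\<^sub>M S" if "w \<in> space M" for w
    using measurable_Pair1'[OF hR[OF that], of S]
    by (simp add: measurable_cong_sets[OF Kp(2)[OF XS[OF that]] refl])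
  have hn: "h w n = X n w" for w by (simp add: h_def)
  have L [measurable]: "L \<in> R \<rightarrow>\<^sub>M prob_algebra (R \<Otimes>\<^sub>M S)"
    unfolding L_def
    by (rule measurable_distr_prob_space2[OF measurable_compose[OF proj K]]) simp
  have D: "D \<in> space (prob_algebra R)"
    by (auto simp: D_def space_prob_algebra intro!: prob_space_distr)
  \<comment> \<open>Both measures are finite and rectangles form an intersection-stable generator,
    so the rectangle identity suffices.\<close>
  have eq: "distr M (R \<Otimes>\<^sub>M S) (\<lambda>w. (h w, X (Suc n) w)) = D \<bind> L"
  proof (rule measure_eqI_generator_eq[OF Int_stable_pair_measure_generator[of R S], where \<Omega> = "space R \<times> space S"
        and A = "\<lambda>_. space R \<times> space S"])
    show "{a \<times> b |a b. a \<in> sets R \<and> b \<in> sets S} \<subseteq> Pow (space R \<times> space S)"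
      by (auto dest: sets.sets_into_space)
    show "sets (distr M (R \<Otimes>\<^sub>M S) (\<lambda>w. (h w, X (Suc n) w))) = sigma_sets (space R \<times> space S) {a \<times> b |a b. a \<in> sets R \<and> b \<in> sets S}"
      by (simp add: sets_pair_measure)
    show "sets (D \<bind> L) = sigma_sets (space R \<times> space S) {a \<times> b |a b. a \<in> sets R \<and> b \<in> sets S}"
      by (simp add: sets_bind'[OF D L] sets_pair_measure)
    show "emeasure (distr M (R \<Otimes>\<^sub>M S) (\<lambda>w. (h w, X (Suc n) w))) (space R \<times> space S) \<noteq> \<infinity>"
      by (subst emeasure_distr) auto
    fix W assume "W \<in> {a \<times> b |a b. a \<in> sets R \<and> b \<in> sets S}"
    then obtain A B where W: "W = A \<times> B" and AB [measurable]: "A \<in> sets R" "B \<in> sets S" by auto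
    have "emeasure (distr M (R \<Otimes>\<^sub>M S) (\<lambda>w. (h w, X (Suc n) w))) W =
        emeasure M {w \<in> space M. h w \<in> A \<and> X (Suc n) w \<in> B}"
      unfolding W by (subst emeasure_distr) (auto intro!: arg_cong2[where f=emeasure])
    also have "\<dots> = (\<integral>\<^sup>+w. indicator A (h w) * emeasure (K (X n w)) B \<partial>M)"
      using markov_chain_step_measure[OF X K, of A n B] AB by (simp add: h_def R_def)
    also have "\<dots> = (\<integral>\<^sup>+w. emeasure (L (h w)) W \<partial>M)"
    proof (intro nn_integral_cong)
      fix w assume w: "w \<in> space M"
      have "emeasure (L (h w)) W = emeasure (K (X n w)) (Pair (h w) -` W \<inter> space (K (X n w)))"
        unfolding L_def hn using W AB Pm[OF w] by (subst emeasure_distr) auto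
      also have "Pair (h w) -` W \<inter> space (K (X n w)) = (if h w \<in> A then B else {})"
        using W sets.sets_into_space[OF AB(2)] sets_eq_imp_space_eq[OF Kp(2)[OF XS[OF w, of n]]] by auto
      finally show "indicator A (h w) * emeasure (K (X n w)) B = emeasure (L (h w)) W"
        by auto
    qed
    also have "\<dots> = (\<integral>\<^sup>+x. emeasure (L x) W \<partial>D)"
      unfolding D_def
      using measurable_prob_algebraD[OF L]
      by (subst nn_integral_distr) (auto simp: W intro!: measurable_emeasure_kernel)
    also have "\<dots> = emeasure (D \<bind> L) W"
      by (rule emeasure_bind_prob_algebra[OF D L, symmetric]) (auto simp: W)
    finally show "emeasure (distr M (R \<Otimes>\<^sub>M S) (\<lambda>w. (h w, X (Suc n) w))) W = emeasure (D \<bind> L) W" .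
  qed auto
  have "(\<integral>w. F (h w, X (Suc n) w) \<partial>M) = (\<integral>p. F p \<partial>(D \<bind> L))"
    by (subst eq[symmetric], subst integral_distr) auto
  also have "\<dots> = (\<integral>x. (\<integral>p. F p \<partial>L x) \<partial>D)"
  proof (rule integral_bind[where K = "R \<Otimes>\<^sub>M S" and B' = 1 and B = C])
    show "L \<in> D \<rightarrow>\<^sub>M subprob_algebra (R \<Otimes>\<^sub>M S)"
      using measurable_prob_algebraD[OF L] by (simp add: D_def)
    show "finite_measure D" using D by (auto simp: space_prob_algebra prob_space_def)
    show "AE x in D. emeasure (L x) (space (L x)) \<le> ennreal 1"
    proof (rule AE_I2)
      fix x assume "x \<in> space D"
      then have "L x \<in> space (prob_algebra (R \<Otimes>\<^sub>M S))" by (intro measurable_space[OF L]) (simp add: D_def)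
      then show "emeasure (L x) (space (L x)) \<le> ennreal 1"
        by (auto simp: space_prob_algebra prob_space.emeasure_space_1)
    qed
  qed (auto simp: D_def C R_def)
  also have "\<dots> = (\<integral>w. (\<integral>p. F p \<partial>L (h w)) \<partial>M)"
    unfolding D_def using measurable_prob_algebraD[OF L]
    by (intro integral_distr measurable_compose[OF _ integral_measurable_subprob_algebra[OF F']]) auto
  also have "\<dots> = (\<integral>w. (\<integral>v. F (h w, v) \<partial>K (X n w)) \<partial>M)"
  proof (intro Bochner_Integration.integral_cong refl)
    fix w assume w: "w \<in> space M"
    show "(\<integral>p. F p \<partial>L (h w)) = (\<integral>v. F (h w, v) \<partial>K (X n w))"
      unfolding L_def hn using Pm[OF w] by (subst integral_distr) auto
  qed
  finally show ?thesis by (simp add: h_def)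
qed

text \<open>Here the integrand varies with \<open>x\<close> as well as the measure. Pushing
  \<open>L x\<close> forward along \<open>Pair x\<close> puts all dependence into the measure, after
  which the integral of a fixed function against a measurable kernel is measurable.\<close>

lemma integral_kernel_measurable:
  fixes f :: "'a \<times> 'b \<Rightarrow> real"
  assumes f: "f \<in> borel_measurable (M \<Otimes>\<^sub>M N)"
    and L: "L \<in> M \<rightarrow>\<^sub>M prob_algebra N"
  shows "(\<lambda>x. \<integral>y. f (x, y) \<partial>L x) \<in> borel_measurable M"
proof -
  have "(\<lambda>x. distr (L x) (M \<Otimes>\<^sub>M N) (Pair x)) \<in> M \<rightarrow>\<^sub>M prob_algebra (M \<Otimes>\<^sub>M N)"
    by (rule measurable_distr_prob_space2[OF L]) simp
  then have "(\<lambda>x. \<integral>p. f p \<partial>distr (L x) (M \<Otimes>\<^sub>M N) (Pair x)) \<in> borel_measurable M"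
    by (intro measurable_compose[OF _ integral_measurable_subprob_algebra[OF f]] measurable_prob_algebraD)
  moreover have "(\<integral>p. f p \<partial>distr (L x) (M \<Otimes>\<^sub>M N) (Pair x)) = (\<integral>y. f (x, y) \<partial>L x)" if "x \<in> space M" for x
  proof -
    have "sets (L x) = sets N" using measurable_space[OF L that] by (simp add: space_prob_algebra)
    then have "Pair x \<in> L x \<rightarrow>\<^sub>M M \<Otimes>\<^sub>M N"
      using measurable_Pair1'[OF that, of N] by (simp cong: measurable_cong_sets)
    then show ?thesis using f by (rule integral_distr)
  qed
  ultimately show ?thesis by (simp cong: measurable_cong)
qed

section \<open>Functionals of finitely many states as iterated integrals\<close>

abbreviation paths :: "(nat \<Rightarrow> real) measure" where
  "paths \<equiv> (\<Pi>\<^sub>M i\<in>UNIV. halfline)"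

text \<open>Paths \<open>z\<close> are on the scale \<open>t\<close>: the chain sits at \<open>t * z k\<close>, and its next state \<open>v\<close> is recorded as \<open>v / t\<close>.\<close>

primrec iter_exp ::
    "(real \<Rightarrow> real measure) \<Rightarrow> real \<Rightarrow> ((nat \<Rightarrow> real) \<Rightarrow> real) \<Rightarrow> nat \<Rightarrow> nat \<Rightarrow> (nat \<Rightarrow> real) \<Rightarrow> real" where
  "iter_exp K t \<phi> 0 k z = \<phi> z"
| "iter_exp K t \<phi> (Suc n) k z = (\<integral>v. iter_exp K t \<phi> n (Suc k) (z(Suc k := v / t)) \<partial>K (t * z k))"

lemma space_halfline [simp]: "space halfline = {0..}"
  by (simp add: space_restrict_space)

lemma space_paths: "z \<in> space paths \<longleftrightarrow> (\<forall>i. 0 \<le> z i)"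
  by (auto simp: space_PiM PiE_iff)

lemma measurable_halflineI:
  assumes "f \<in> borel_measurable M" "\<And>x. x \<in> space M \<Longrightarrow> 0 \<le> f x"
  shows "f \<in> M \<rightarrow>\<^sub>M halfline"
  using assms by (intro measurable_restrict_space2) auto

lemma measurable_halflineD: "f \<in> M \<rightarrow>\<^sub>M halfline \<Longrightarrow> f \<in> borel_measurable M"
  by (simp add: measurable_restrict_space2_iff)

lemma markov_kernelD:
  assumes "markov_kernel halfline K" "0 \<le> x"
  shows "prob_space (K x)" "sets (K x) = sets halfline" "space (K x) = {0..}"
  using measurable_space[OF assms(1), of x] assms(2)
  by (auto simp: space_prob_algebra dest: sets_eq_imp_space_eq)

lemma measurable_fun_upd_paths:
  assumes "0 \<le> (t::real)"
  shows "(\<lambda>p. (fst p)(k := snd p / t)) \<in> paths \<Otimes>\<^sub>M halfline \<rightarrow>\<^sub>M paths"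
proof (rule measurable_PiM_single')
  fix i :: nat
  have c: "(\<lambda>p. fst p i) \<in> paths \<Otimes>\<^sub>M halfline \<rightarrow>\<^sub>M halfline" by measurable
  have s: "snd \<in> borel_measurable (paths \<Otimes>\<^sub>M halfline)" by (rule measurable_halflineD) measurable
  show "(\<lambda>p. ((fst p)(k := snd p / t)) i) \<in> paths \<Otimes>\<^sub>M halfline \<rightarrow>\<^sub>M halfline"
    using c s assms by (cases "i = k") (auto intro!: measurable_halflineI simp: space_pair_measure)
qed (use assms in \<open>auto simp: space_pair_measure space_PiM PiE_iff\<close>)

lemma iter_exp_measurable:
  assumes K: "markov_kernel halfline K" and \<phi>: "\<phi> \<in> borel_measurable paths" and t: "0 \<le> t"
  shows "iter_exp K t \<phi> n k \<in> borel_measurable paths"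
proof (induction n arbitrary: k)
  case 0
  then show ?case using \<phi> by simp
next
  case (Suc n)
  have c: "(\<lambda>z. z k) \<in> paths \<rightarrow>\<^sub>M halfline" by measurable
  have "(\<lambda>z. t * z k) \<in> paths \<rightarrow>\<^sub>M halfline"
    using measurable_halflineD[OF c] t by (intro measurable_halflineI) (auto simp: space_paths)
  then have "(\<lambda>z. K (t * z k)) \<in> paths \<rightarrow>\<^sub>M prob_algebra halfline"
    by (rule measurable_compose[OF _ K])
  from integral_kernel_measurable[OF measurable_compose[OF measurable_fun_upd_paths[OF t] Suc] this]
  have "(\<lambda>z. \<integral>v. iter_exp K t \<phi> n (Suc k) (z(Suc k := v / t)) \<partial>K (t * z k)) \<in> borel_measurable paths"
    by (simp only: fst_conv snd_conv)
  moreover have "iter_exp K t \<phi> (Suc n) k = (\<lambda>z. \<integral>v. iter_exp K t \<phi> n (Suc k) (z(Suc k := v / t)) \<partial>K (t * z k))"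
    by (rule ext) simp
  ultimately show ?case by (simp only:)
qed

lemma iter_exp_bound:
  assumes K: "markov_kernel halfline K" and t: "0 \<le> t"
    and C: "\<And>z. z \<in> space paths \<Longrightarrow> \<bar>\<phi> z\<bar> \<le> C"
  shows "z \<in> space paths \<Longrightarrow> \<bar>iter_exp K t \<phi> n k z\<bar> \<le> C"
proof (induction n arbitrary: k z)
  case 0
  then show ?case using C by simp
next
  case (Suc n)
  have z: "0 \<le> z i" for i using Suc.prems by (simp add: space_paths)
  have "0 \<le> C" using C[OF Suc.prems] by linarith
  moreover have "\<bar>iter_exp K t \<phi> n (Suc k) (z(Suc k := v / t))\<bar> \<le> C" if "v \<in> space (K (t * z k))" for v
    using that markov_kernelD(3)[OF K, of "t * z k"] z t by (intro Suc.IH) (auto simp: space_paths)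
  ultimately show ?case
    using prob_space.abs_integral_le_bound[OF markov_kernelD(1)[OF K, of "t * z k"]] z t by simp
qed

text \<open>The remaining \<open>n\<close> integrations overwrite the coordinates
  \<open>k + 1, ..., m\<close>, so only those up to \<open>k\<close> matter. This permits arbitrary
  placeholder values in the rest of the path.\<close>

lemma iter_exp_cong:
  assumes "\<And>z z'. (\<And>i. i \<le> m \<Longrightarrow> z i = z' i) \<Longrightarrow> \<phi> z = \<phi> z'"
  shows "n + k = m \<Longrightarrow> (\<And>i. i \<le> k \<Longrightarrow> z i = z' i) \<Longrightarrow> iter_exp K t \<phi> n k z = iter_exp K t \<phi> n k z'"
proof (induction n arbitrary: k z z')
  case 0
  have "\<phi> z = \<phi> z'" by (rule assms) (use 0 in simp)
  then show ?case by simp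
next
  case (Suc n)
  have "iter_exp K t \<phi> n (Suc k) (z(Suc k := v / t)) = iter_exp K t \<phi> n (Suc k) (z'(Suc k := v / t))" for v
    using Suc.prems by (intro Suc.IH) (auto simp: le_Suc_eq)
  then show ?case using Suc.prems(2)[of k] by simp
qed

text \<open>Later integrations only change coordinates beyond \<open>k\<close>, so a violation at
  some \<open>i \<le> k\<close> persists down to the innermost integrand.\<close>

lemma iter_exp_zero:
  assumes "\<And>z. P (z i) \<Longrightarrow> \<phi> z = 0"
  shows "i \<le> k \<Longrightarrow> P (z i) \<Longrightarrow> iter_exp K t \<phi> n k z = 0"
proof (induction n arbitrary: k z)
  case 0
  then show ?case using assms by simp
next
  case (Suc n)
  have "iter_exp K t \<phi> n (Suc k) (z(Suc k := v / t)) = 0" for v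
    using Suc.prems by (intro Suc.IH) auto
  then show ?case by simp
qed

text \<open>Conditioning on the states up to time \<open>k\<close> integrates out the state at time
  \<open>k + 1\<close>: one step of the tower property.\<close>

lemma markov_chain_iter_exp_step:
  assumes X: "markov_chain halfline K M X" and K: "markov_kernel halfline K"
    and \<phi>: "\<phi> \<in> borel_measurable paths" and t: "0 < t"
    and C: "\<And>z. z \<in> space paths \<Longrightarrow> \<bar>\<phi> z\<bar> \<le> C"
    and loc: "\<And>z z'. (\<And>i. i \<le> m \<Longrightarrow> z i = z' i) \<Longrightarrow> \<phi> z = \<phi> z'"
    and m: "n + Suc k = m"
  shows "(\<integral>w. iter_exp K t \<phi> n (Suc k) (\<lambda>i. X i w / t) \<partial>M) =
    (\<integral>w. iter_exp K t \<phi> (Suc n) k (\<lambda>i. X i w / t) \<partial>M)"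
proof -
  let ?R = "(\<Pi>\<^sub>M i\<in>{..k}. halfline) \<Otimes>\<^sub>M halfline"
  \<comment> \<open>Rebuilds a full path from history and next state. The next state fills every
    coordinate beyond \<open>k\<close>; by locality only coordinate \<open>k + 1\<close> is
    read.\<close>
  define e :: "(nat \<Rightarrow> real) \<times> real \<Rightarrow> nat \<Rightarrow> real"
    where "e = (\<lambda>p i. if i \<le> k then fst p i / t else snd p / t)"
  have e: "e \<in> ?R \<rightarrow>\<^sub>M paths"
    unfolding e_def
  proof (rule measurable_PiM_single')
    fix i
    show "(\<lambda>p. if i \<le> k then fst p i / t else snd p / t) \<in> ?R \<rightarrow>\<^sub>M halfline"
    proof (cases "i \<le> k")
      case True
      then have c: "(\<lambda>p. fst p i) \<in> ?R \<rightarrow>\<^sub>M halfline"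
        by (intro measurable_compose[OF measurable_fst measurable_component_singleton]) simp
      with True t show ?thesis
        using measurable_halflineD[OF c] measurable_space[OF c] by (auto intro!: measurable_halflineI)
    next
      case False
      have s: "snd \<in> borel_measurable ?R" by (rule measurable_halflineD) measurable
      with False t show ?thesis by (auto intro!: measurable_halflineI simp: space_pair_measure)
    qed
  qed (use t in \<open>auto simp: space_pair_measure space_PiM PiE_iff\<close>)
  define F where "F = (\<lambda>p. iter_exp K t \<phi> n (Suc k) (e p))"
  have F: "F \<in> borel_measurable ?R"
    unfolding F_def using t by (intro measurable_compose[OF e] iter_exp_measurable[OF K \<phi>]) auto
  have FC: "\<bar>F p\<bar> \<le> C" if "p \<in> space ?R" for p
    unfolding F_def using t measurable_space[OF e that] by (intro iter_exp_bound[OF K _ C]) auto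
  have "iter_exp K t \<phi> n (Suc k) (\<lambda>i. X i w / t) = F (\<lambda>i\<in>{..k}. X i w, X (Suc k) w)" for w
    unfolding F_def by (rule iter_exp_cong[OF loc m]) (auto simp: e_def le_Suc_eq)
  moreover have "iter_exp K t \<phi> (Suc n) k (\<lambda>i. X i w / t) = (\<integral>v. F (\<lambda>i\<in>{..k}. X i w, v) \<partial>K (X k w))" for w
  proof -
    have "iter_exp K t \<phi> n (Suc k) ((\<lambda>i. X i w / t)(Suc k := v / t)) = F (\<lambda>i\<in>{..k}. X i w, v)" for v
      unfolding F_def by (rule iter_exp_cong[OF loc m]) (auto simp: e_def le_Suc_eq)
    then show ?thesis using t by simp
  qed
  ultimately show ?thesis
    using markov_chain_step[OF X K F FC] by simp
qed

lemma markov_family_iter_exp: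
  assumes X: "markov_family halfline K P X" and K: "markov_kernel halfline K"
    and \<phi>: "\<phi> \<in> borel_measurable paths" and t: "0 < t" and x: "0 \<le> x"
    and C: "\<And>z. z \<in> space paths \<Longrightarrow> \<bar>\<phi> z\<bar> \<le> C"
    and loc: "\<And>z z'. (\<And>i. i \<le> m \<Longrightarrow> z i = z' i) \<Longrightarrow> \<phi> z = \<phi> z'"
  shows "(\<integral>w. \<phi> (\<lambda>i. X i w / t) \<partial>P (t * x)) = iter_exp K t \<phi> m 0 (\<lambda>_. x)"
proof -
  let ?M = "P (t * x)"
  have mc: "markov_chain halfline K ?M X" and start: "AE w in ?M. X 0 w = t * x"
    using X t x by (auto simp: markov_family_def)
  interpret prob_space ?M using mc by (simp add: markov_chain_def)
  have Xm: "X i \<in> ?M \<rightarrow>\<^sub>M halfline" for i using mc by (simp add: markov_chain_def)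
  note step = markov_chain_iter_exp_step[OF mc K \<phi> t C loc]
  \<comment> \<open>Here \<open>n\<close> counts the states already integrated out, starting from
    the last one.\<close>
  have "(\<integral>w. \<phi> (\<lambda>i. X i w / t) \<partial>?M) = (\<integral>w. iter_exp K t \<phi> n (m - n) (\<lambda>i. X i w / t) \<partial>?M)"
    if "n \<le> m" for n
    using that
  proof (induction n)
    case (Suc n)
    then show ?case
      using step[of m n "m - Suc n"] by (simp add: Suc_diff_Suc del: iter_exp.simps(2))
  qed simp
  from this[of m] have "(\<integral>w. \<phi> (\<lambda>i. X i w / t) \<partial>?M) = (\<integral>w. iter_exp K t \<phi> m 0 (\<lambda>i. X i w / t) \<partial>?M)"
    by simp
  \<comment> \<open>Only coordinate 0 is still read, and it is almost surely \<open>x\<close>; the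
    constant path is a convenient representative.\<close>
  also have "\<dots> = (\<integral>w. iter_exp K t \<phi> m 0 (\<lambda>_. x) \<partial>?M)"
  proof (intro integral_cong_AE)
    have "(\<lambda>w i. X i w / t) \<in> ?M \<rightarrow>\<^sub>M paths"
    proof (rule measurable_PiM_single')
      show "(\<lambda>w. X i w / t) \<in> ?M \<rightarrow>\<^sub>M halfline" for i
        using measurable_halflineD[OF Xm] measurable_space[OF Xm] t by (intro measurable_halflineI) auto
    qed (use measurable_space[OF Xm] t in \<open>auto simp: PiE_iff\<close>)
    then show "(\<lambda>w. iter_exp K t \<phi> m 0 (\<lambda>i. X i w / t)) \<in> borel_measurable ?M"
      using t by (intro measurable_compose[OF _ iter_exp_measurable[OF K \<phi>]]) auto
    show "AE w in ?M. iter_exp K t \<phi> m 0 (\<lambda>i. X i w / t) = iter_exp K t \<phi> m 0 (\<lambda>_. x)"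
      using start by eventually_elim (rule iter_exp_cong[OF loc], use t in auto)
  qed simp
  finally show ?thesis by (simp add: prob_space)
qed

subsection \<open>Convergence of a single transition\<close>

text \<open>Replacing \<open>s n\<close> by \<open>max 1 (s n)\<close> changes only finitely many
  terms. Positivity is wanted for every \<open>n\<close> because the states are divided by
  \<open>s n\<close>.\<close>

lemma tendsto_at_top_positive_sequencesI:
  fixes g :: "real \<Rightarrow> 'b::first_countable_topology"
  assumes "\<And>s. (\<And>n. 0 < s n) \<Longrightarrow> filterlim s at_top sequentially \<Longrightarrow> (\<lambda>n. g (s n)) \<longlonglongrightarrow> L"
  shows "(g \<longlongrightarrow> L) at_top"
proof (rule tendsto_at_topI_sequentially)
  fix s :: "nat \<Rightarrow> real" assume s: "filterlim s at_top sequentially"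
  then have ev: "\<forall>\<^sub>F n in sequentially. max 1 (s n) = s n"
    unfolding filterlim_at_top by (auto elim: eventually_mono[OF spec[of _ 1]])
  have "filterlim (\<lambda>n. max 1 (s n)) at_top sequentially"
    using s by (rule filterlim_mono_eventually) (use ev in \<open>auto elim: eventually_mono\<close>)
  then have "(\<lambda>n. g (max 1 (s n))) \<longlonglongrightarrow> L" by (intro assms) auto
  then show "(\<lambda>n. g (s n)) \<longlonglongrightarrow> L"
    by (rule Lim_transform_eventually) (use ev in eventually_elim, simp)
qed

text \<open>
  A sequence \<open>s n\<close> may take a value repeatedly; the function \<open>u\<close> picks, among the finitely many
  \<open>x n\<close> with \<open>s n = t\<close>, one for which \<open>g t (x n)\<close> is farthest from the limit.
\<close>

lemma uniform_limit_along_sequence: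
  fixes g :: "real \<Rightarrow> real \<Rightarrow> 'b::metric_space"
  assumes U: "\<And>u. (\<forall>t\<ge>0. 0 \<le> u t) \<Longrightarrow> (u \<longlongrightarrow> a) at_top \<Longrightarrow> ((\<lambda>t. g t (u t)) \<longlongrightarrow> L) at_top"
    and s: "filterlim s at_top sequentially"
    and x: "\<And>n. 0 \<le> x n" "x \<longlonglongrightarrow> a"
  shows "(\<lambda>n. g (s n) (x n)) \<longlonglongrightarrow> L"
proof -
  have a: "0 \<le> a" using x by (intro LIMSEQ_le_const[OF x(2)]) auto
  define I where "I t = {n. s n = t}" for t
  have fin: "finite (I t)" for t
  proof -
    have "\<forall>\<^sub>F n in sequentially. s n > t" using s by (auto simp: filterlim_at_top_dense)
    then obtain N where "\<forall>n\<ge>N. s n > t" by (auto simp: eventually_sequentially)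
    then have "I t \<subseteq> {..<N}" by (auto simp: I_def simp flip: not_le)
    then show ?thesis by (rule finite_subset) simp
  qed
  have "\<exists>n. I t \<noteq> {} \<longrightarrow> n \<in> I t \<and> (\<forall>k\<in>I t. dist (g t (x k)) L \<le> dist (g t (x n)) L)" for t
  proof (cases "I t = {}")
    case False
    let ?D = "(\<lambda>n. dist (g t (x n)) L) ` I t"
    have "Max ?D \<in> ?D" using fin False by (intro Max_in) auto
    then obtain n where "n \<in> I t" "Max ?D = dist (g t (x n)) L" by auto
    moreover have "dist (g t (x k)) L \<le> Max ?D" if "k \<in> I t" for k
      using fin that by (intro Max_ge) auto
    ultimately show ?thesis by metis
  qed auto
  then obtain pick where pick: "I t \<noteq> {} \<Longrightarrow> pick t \<in> I t"
      "\<And>k. k \<in> I t \<Longrightarrow> dist (g t (x k)) L \<le> dist (g t (x (pick t))) L" for t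
    by (metis empty_iff)
  \<comment> \<open>At times that the sequence never hits, the limit \<open>a\<close> itself keeps
    \<open>u\<close> non-negative and convergent.\<close>
  define u where "u t = (if I t = {} then a else x (pick t))" for t
  have "(u \<longlongrightarrow> a) at_top"
  proof (rule tendstoI)
    fix e :: real assume e: "0 < e"
    then have "\<forall>\<^sub>F n in sequentially. dist (x n) a < e" using x(2) by (auto dest: tendstoD)
    then obtain N where N: "\<forall>n\<ge>N. dist (x n) a < e" by (auto simp: eventually_sequentially)
    have "\<forall>\<^sub>F t in at_top. \<forall>n\<in>{..<N}. s n < t"
      by (intro eventually_ball_finite) (auto intro: eventually_gt_at_top)
    then show "\<forall>\<^sub>F t in at_top. dist (u t) a < e"
    proof eventually_elim
      case (elim t)
      show ?case
      proof (cases "I t = {}")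
        case False
        then have "s (pick t) = t" using pick(1)[of t] by (simp add: I_def)
        \<comment> \<open>\<open>t\<close> exceeds the first \<open>N\<close> values of
          \<open>s\<close>, so an index at which \<open>s\<close> hits \<open>t\<close> is at least
          \<open>N\<close>.\<close>
        then have "N \<le> pick t" using elim by (metis lessThan_iff less_irrefl not_le)
        then show ?thesis using N False by (simp add: u_def)
      qed (simp add: u_def e)
    qed
  qed
  moreover have "\<forall>t\<ge>0. 0 \<le> u t" using x(1) a by (simp add: u_def)
  ultimately have "((\<lambda>t. g t (u t)) \<longlongrightarrow> L) at_top" by (intro U)
  from filterlim_compose[OF this s] have "(\<lambda>n. g (s n) (u (s n))) \<longlonglongrightarrow> L" .
  moreover have "dist (g (s n) (x n)) L \<le> dist (g (s n) (u (s n))) L" for n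
  proof -
    have "n \<in> I (s n)" by (simp add: I_def)
    then show ?thesis using pick(2)[of n "s n"] by (auto simp: u_def)
  qed
  ultimately show ?thesis by (auto intro: metric_tendsto_imp_tendsto)
qed

section \<open>Almost sure representation of the rescaled transition laws\<close>

lemma borel_measurable_from_halfline:
  assumes "sets N = sets halfline" "f \<in> borel_measurable borel"
  shows "f \<in> borel_measurable N"
  using measurable_restrict_space1[OF assms(2), of "{0..}"] assms(1)
  by (simp cong: measurable_cong_sets)

lemma continuous_on_cts_step:
  assumes "a < b"
  shows "continuous_on UNIV (cts_step a b)"
  using cts_step_uniformly_continuous[OF assms] by (rule uniformly_continuous_imp_continuous)

text \<open>Bridges two sets of test functions: weak convergence on the real line is checked on
  continuous steps, whereas \<open>D(G)\<close> speaks of continuous functions on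
  \<open>[0,infinity]\<close>.\<close>

lemma cts_step_extends_to_ennreal:
  assumes "a < b"
  obtains f :: "ennreal \<Rightarrow> real" where "continuous_on UNIV f" "bounded (range f)"
    "\<And>v. 0 \<le> v \<Longrightarrow> f (ennreal v) = cts_step a b v"
proof
  \<comment> \<open>On \<open>[0,infinity)\<close> the step is constant from \<open>c\<close> on, so
    truncating at \<open>c\<close> preserves its values there and makes it continuous at infinity.
    The maximum covers negative \<open>b\<close>.\<close>
  define c where "c = max 0 b"
  let ?f = "\<lambda>e. cts_step a b (enn2real (min e (ennreal c)))"
  have "isCont (\<lambda>e. enn2real (min e (ennreal c))) e" for e
    unfolding isCont_def
  proof (rule tendsto_enn2real)
    have "ennreal (enn2real (min e (ennreal c))) = min e (ennreal c)"
      by (rule ennreal_enn2real) (auto simp: min_less_iff_disj)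
    then show "(\<lambda>e. min e (ennreal c)) \<midarrow>e\<rightarrow> ennreal (enn2real (min e (ennreal c)))"
      by (simp only:) (intro tendsto_min tendsto_ident_at tendsto_const)
  qed simp
  then have "continuous_on UNIV (\<lambda>e. enn2real (min e (ennreal c)))"
    by (intro continuous_at_imp_continuous_on) auto
  then show "continuous_on UNIV ?f"
    by (rule continuous_on_compose2[OF continuous_on_cts_step[OF assms]]) auto
  show "bounded (range ?f)"
    using assms by (intro boundedI[of _ 1]) (auto simp: cts_step_def)
  show "?f (ennreal v) = cts_step a b v" if "0 \<le> v" for v
    using that assms by (auto simp: cts_step_def c_def min_def ennreal_le_iff max_def)
qed

text \<open>With \<open>r n = s n * x n\<close>, which tends to infinity because
  \<open>x0 > 0\<close>, the diagonal laws of \<open>v / r n\<close> converge to \<open>G\<close>.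
  Skorohod turns them into pointwise convergent \<open>Z n\<close>, and
  \<open>v / s n = x n * (v / r n)\<close> suggests \<open>x n * Z n\<close> as the representing
  variables.\<close>

lemma domain_of_attraction_representation:
  assumes G: "prob_on halfline G" and K: "markov_kernel halfline K"
    and KG: "in_domain_of_attraction K G"
    and s: "\<And>n. 0 < s n" "filterlim s at_top sequentially"
    and x: "\<And>n. 0 \<le> x n" "x \<longlonglongrightarrow> x0" "0 < x0"
  obtains \<Omega> :: "real measure" and Y Y0 where "prob_space \<Omega>"
    "\<And>n. Y n \<in> borel_measurable \<Omega>" "Y0 \<in> borel_measurable \<Omega>"
    "\<And>\<omega>. \<omega> \<in> space \<Omega> \<Longrightarrow> (\<lambda>n. Y n \<omega>) \<longlonglongrightarrow> Y0 \<omega>"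
    "\<forall>\<^sub>F n in sequentially. distr \<Omega> borel (Y n) = distr (K (s n * x n)) borel (\<lambda>v. v / s n)"
    "distr \<Omega> borel Y0 = distr G borel (\<lambda>v. x0 * v)"
proof -
  have Gp: "prob_space G" "sets G = sets halfline" using G by (auto simp: prob_on_def)
  have Gs: "space G = {0..}" using sets_eq_imp_space_eq[OF Gp(2)] by simp
  define r where "r n = s n * x n" for n
  have r0: "0 \<le> r n" for n unfolding r_def using s(1)[of n] x(1)[of n] by simp
  have r: "filterlim r at_top sequentially"
    unfolding r_def using filterlim_tendsto_pos_mult_at_top[OF x(2,3) s(2)] by (simp add: mult.commute)
  note Kr = markov_kernelD[OF K r0]
  note Km = borel_measurable_from_halfline[OF Kr(2)]
  note Gm = borel_measurable_from_halfline[OF Gp(2)]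
  have div [measurable]: "(\<lambda>v::real. v / c) \<in> borel_measurable borel" for c by measurable
  define \<mu> where "\<mu> n = distr (K (r n)) borel (\<lambda>v. v / r n)" for n
  define \<nu> where "\<nu> = distr G borel (\<lambda>v. v)"
  have \<mu>: "real_distribution (\<mu> n)" for n
    unfolding \<mu>_def real_distribution_def real_distribution_axioms_def
    by (auto intro!: prob_space.prob_space_distr Kr Km)
  have \<nu>: "real_distribution \<nu>"
    unfolding \<nu>_def real_distribution_def real_distribution_axioms_def
    by (auto intro!: prob_space.prob_space_distr Gp Gm)
  have "weak_conv_m \<mu> \<nu>"
  proof (rule integral_cts_step_conv_imp_weak_conv[OF \<mu> \<nu>])
    fix a b :: real assume ab: "a < b"
    obtain f :: "ennreal \<Rightarrow> real" where f: "continuous_on UNIV f" "bounded (range f)"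
      "\<And>v. 0 \<le> v \<Longrightarrow> f (ennreal v) = cts_step a b v"
      using cts_step_extends_to_ennreal[OF ab] by blast
    have fm: "f \<in> borel_measurable borel" using f(1) by (rule borel_measurable_continuous_onI)
    have cm: "cts_step a b \<in> borel_measurable borel"
      using continuous_on_cts_step[OF ab] by (rule borel_measurable_continuous_onI)
    have "((\<lambda>t. \<integral>e. f e \<partial>distr (K t) borel (\<lambda>x. ennreal (x / t))) \<longlongrightarrow> (\<integral>e. f e \<partial>distr G borel ennreal)) at_top"
      using KG f(1,2) unfolding in_domain_of_attraction_def weak_conv_in_def by simp
    from filterlim_compose[OF this r]
    have "(\<lambda>n. \<integral>e. f e \<partial>distr (K (r n)) borel (\<lambda>x. ennreal (x / r n))) \<longlonglongrightarrow> (\<integral>e. f e \<partial>distr G borel ennreal)" .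
    moreover have "(\<integral>e. f e \<partial>distr (K (r n)) borel (\<lambda>x. ennreal (x / r n))) = integral\<^sup>L (\<mu> n) (cts_step a b)" for n
    proof -
      have "(\<integral>e. f e \<partial>distr (K (r n)) borel (\<lambda>x. ennreal (x / r n))) = (\<integral>v. f (ennreal (v / r n)) \<partial>K (r n))"
        by (rule integral_distr[OF Km fm]) measurable
      also have "\<dots> = (\<integral>v. cts_step a b (v / r n) \<partial>K (r n))"
        using Kr(3) r0 by (intro Bochner_Integration.integral_cong) (auto intro!: f(3))
      also have "\<dots> = integral\<^sup>L (\<mu> n) (cts_step a b)"
        unfolding \<mu>_def by (rule integral_distr[OF Km cm, symmetric]) measurable
      finally show ?thesis .
    qed
    moreover have "(\<integral>e. f e \<partial>distr G borel ennreal) = integral\<^sup>L \<nu> (cts_step a b)"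
    proof -
      have "(\<integral>e. f e \<partial>distr G borel ennreal) = (\<integral>v. f (ennreal v) \<partial>G)"
        by (rule integral_distr[OF Gm fm]) measurable
      also have "\<dots> = (\<integral>v. cts_step a b v \<partial>G)"
        using Gs by (intro Bochner_Integration.integral_cong) (auto intro!: f(3))
      also have "\<dots> = integral\<^sup>L \<nu> (cts_step a b)"
        unfolding \<nu>_def by (rule integral_distr[OF Gm cm, symmetric]) measurable
      finally show ?thesis .
    qed
    ultimately show "(\<lambda>n. integral\<^sup>L (\<mu> n) (cts_step a b)) \<longlonglongrightarrow> integral\<^sup>L \<nu> (cts_step a b)" by simp
  qed
  from Skorohod[OF \<mu> \<nu> this] obtain \<Omega> :: "real measure" and Z Z0 where
    \<Omega>: "prob_space \<Omega>" and Z [measurable]: "\<And>n. Z n \<in> borel_measurable \<Omega>"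
    and dZ: "\<And>n. distr \<Omega> borel (Z n) = \<mu> n"
    and Z0: "Z0 \<in> \<Omega> \<rightarrow>\<^sub>M lborel" and dZ0: "distr \<Omega> borel Z0 = \<nu>"
    and lim: "\<And>\<omega>. \<omega> \<in> space \<Omega> \<Longrightarrow> (\<lambda>n. Z n \<omega>) \<longlonglongrightarrow> Z0 \<omega>"
    by blast
  have [measurable]: "Z0 \<in> borel_measurable \<Omega>" using Z0 by simp
  show thesis
  proof
    show "prob_space \<Omega>" by fact
    show "(\<lambda>\<omega>. x n * Z n \<omega>) \<in> borel_measurable \<Omega>" for n by measurable
    show "(\<lambda>\<omega>. x0 * Z0 \<omega>) \<in> borel_measurable \<Omega>" by measurable
    show "(\<lambda>n. x n * Z n \<omega>) \<longlonglongrightarrow> x0 * Z0 \<omega>" if "\<omega> \<in> space \<Omega>" for \<omega>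
      using x(2) lim[OF that] by (rule tendsto_mult)
    have "distr \<Omega> borel (\<lambda>\<omega>. x0 * Z0 \<omega>) = distr (distr \<Omega> borel Z0) borel (\<lambda>v. x0 * v)"
      by (subst distr_distr) (auto simp: comp_def)
    also have "\<dots> = distr G borel (\<lambda>v. x0 * v)"
      unfolding dZ0 \<nu>_def by (subst distr_distr) (auto simp: comp_def intro!: Gm)
    finally show "distr \<Omega> borel (\<lambda>\<omega>. x0 * Z0 \<omega>) = distr G borel (\<lambda>v. x0 * v)" .
    have "\<forall>\<^sub>F n in sequentially. 0 < x n" using x(2,3) by (auto dest: order_tendstoD)
    then show "\<forall>\<^sub>F n in sequentially. distr \<Omega> borel (\<lambda>\<omega>. x n * Z n \<omega>) = distr (K (s n * x n)) borel (\<lambda>v. v / s n)"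
    proof eventually_elim
      case (elim n)
      have "distr \<Omega> borel (\<lambda>\<omega>. x n * Z n \<omega>) = distr (distr \<Omega> borel (Z n)) borel (\<lambda>v. x n * v)"
        by (subst distr_distr) (auto simp: comp_def)
      also have "\<dots> = distr (K (r n)) borel (\<lambda>v. x n * (v / r n))"
        unfolding dZ \<mu>_def by (subst distr_distr) (auto simp: comp_def intro!: Km)
      \<comment> \<open>At \<open>x n = 0\<close> the left side would be constantly 0, so the laws
        are identified only for large \<open>n\<close>.\<close>
      also have "(\<lambda>v. x n * (v / r n)) = (\<lambda>v. v / s n)"
        using elim s(1)[of n] by (auto simp: r_def)
      finally show ?case by (simp add: r_def)
    qed
  qed
qed

text \<open>Split \<open>Y n \<le> b n\<close> according to the sign of \<open>Y0\<close>. Where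
  \<open>Y0 > 0\<close>, eventually \<open>Y n > b n\<close>, so this part loses its mass by
  dominated convergence. The part with \<open>Y0 \<le> 0\<close> therefore carries all of the
  limiting mass of \<open>Y0 \<le> 0\<close>, and nothing is left above \<open>b n\<close>.\<close>

lemma boundary_mass_vanishes:
  fixes Y :: "nat \<Rightarrow> 'w \<Rightarrow> real" and b :: "nat \<Rightarrow> real"
  assumes "prob_space M"
    and Y [measurable]: "\<And>n. Y n \<in> borel_measurable M" "Y0 \<in> borel_measurable M"
    and lim: "\<And>w. w \<in> space M \<Longrightarrow> (\<lambda>n. Y n w) \<longlonglongrightarrow> Y0 w"
    and b: "b \<longlonglongrightarrow> 0"
    and mass: "(\<lambda>n. measure M {w \<in> space M. Y n w \<le> b n}) \<longlonglongrightarrow> measure M {w \<in> space M. Y0 w \<le> 0}"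
  shows "(\<lambda>n. measure M {w \<in> space M. b n < Y n w \<and> Y0 w \<le> 0}) \<longlonglongrightarrow> 0"
proof -
  interpret prob_space M by fact
  have "(\<lambda>n. \<integral>w. indicator {w \<in> space M. Y n w \<le> b n \<and> 0 < Y0 w} w \<partial>M) \<longlonglongrightarrow> (\<integral>w. 0 \<partial>M :: real)"
  proof (rule integral_dominated_convergence[where w = "\<lambda>_. 1"])
    show "AE w in M. (\<lambda>n. indicator {w \<in> space M. Y n w \<le> b n \<and> 0 < Y0 w} w :: real) \<longlonglongrightarrow> 0"
    proof (rule AE_I2)
      fix w assume w: "w \<in> space M"
      show "(\<lambda>n. indicator {w \<in> space M. Y n w \<le> b n \<and> 0 < Y0 w} w :: real) \<longlonglongrightarrow> 0"
      proof (cases "0 < Y0 w")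
        case True
        have "(\<lambda>n. Y n w - b n) \<longlonglongrightarrow> Y0 w - 0" by (intro tendsto_diff lim w b)
        then have "\<forall>\<^sub>F n in sequentially. 0 < Y n w - b n" using True by (auto dest: order_tendstoD)
        then show ?thesis by (intro tendsto_eventually) (auto elim!: eventually_mono)
      qed simp
    qed
  qed (auto simp: indicator_def)
  then have "(\<lambda>n. measure M {w \<in> space M. Y n w \<le> b n \<and> 0 < Y0 w}) \<longlonglongrightarrow> 0" by simp
  with mass have "(\<lambda>n. measure M {w \<in> space M. Y0 w \<le> 0} -
      (measure M {w \<in> space M. Y n w \<le> b n} - measure M {w \<in> space M. Y n w \<le> b n \<and> 0 < Y0 w}))
      \<longlonglongrightarrow> measure M {w \<in> space M. Y0 w \<le> 0} - (measure M {w \<in> space M. Y0 w \<le> 0} - 0)"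
    by (intro tendsto_intros)
  moreover have "measure M {w \<in> space M. Y0 w \<le> 0} -
      (measure M {w \<in> space M. Y n w \<le> b n} - measure M {w \<in> space M. Y n w \<le> b n \<and> 0 < Y0 w}) =
      measure M {w \<in> space M. b n < Y n w \<and> Y0 w \<le> 0}" for n
  proof -
    have "measure M {w \<in> space M. Y0 w \<le> 0} = measure M {w \<in> space M. Y n w \<le> b n \<and> Y0 w \<le> 0} +
        measure M {w \<in> space M. b n < Y n w \<and> Y0 w \<le> 0}"
      by (subst finite_measure_Union[symmetric]) (auto intro!: arg_cong[where f="measure M"])
    moreover have "measure M {w \<in> space M. Y n w \<le> b n} = measure M {w \<in> space M. Y n w \<le> b n \<and> Y0 w \<le> 0} +
        measure M {w \<in> space M. Y n w \<le> b n \<and> 0 < Y0 w}"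
      by (subst finite_measure_Union[symmetric]) (auto intro!: arg_cong[where f="measure M"])
    ultimately show ?thesis by simp
  qed
  ultimately show ?thesis by simp
qed

text \<open>
  Continuous convergence of \<open>h n\<close> to \<open>h0\<close> may fail at \<open>0\<close>, which can be an atom of the limit;
  then \<open>h n\<close> must vanish below a boundary that captures exactly the mass of that atom.
\<close>

lemma expectation_tendsto_with_boundary:
  fixes Y h :: "nat \<Rightarrow> _ \<Rightarrow> real" and b :: "nat \<Rightarrow> real"
  assumes M: "prob_space M"
    and Y [measurable]: "\<And>n. Y n \<in> borel_measurable M" "Y0 \<in> borel_measurable M"
    and lim: "\<And>w. w \<in> space M \<Longrightarrow> (\<lambda>n. Y n w) \<longlonglongrightarrow> Y0 w"
    and nonneg: "AE w in M. 0 \<le> Y0 w"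
    and h [measurable]: "\<And>n. h n \<in> borel_measurable borel" "h0 \<in> borel_measurable borel"
    and C: "\<And>n v. \<bar>h n v\<bar> \<le> C"
    and conv: "\<And>v vs. 0 < v \<Longrightarrow> vs \<longlonglongrightarrow> v \<Longrightarrow> (\<lambda>n. h n (vs n)) \<longlonglongrightarrow> h0 v"
    and zero: "(\<forall>vs. vs \<longlonglongrightarrow> 0 \<longrightarrow> (\<lambda>n. h n (vs n)) \<longlonglongrightarrow> h0 0) \<or>
      (h0 0 = 0 \<and> (\<forall>n v. v \<le> b n \<longrightarrow> h n v = 0) \<and> b \<longlonglongrightarrow> 0 \<and>
       (\<lambda>n. measure M {w \<in> space M. Y n w \<le> b n}) \<longlonglongrightarrow> measure M {w \<in> space M. Y0 w \<le> 0})"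
  shows "(\<lambda>n. \<integral>w. h n (Y n w) \<partial>M) \<longlonglongrightarrow> (\<integral>w. h0 (Y0 w) \<partial>M)"
proof -
  interpret prob_space M by fact
  have C0: "0 \<le> C" using order_trans[OF abs_ge_zero C] .
  show ?thesis
    using zero
  proof
    assume z: "\<forall>vs. vs \<longlonglongrightarrow> 0 \<longrightarrow> (\<lambda>n. h n (vs n)) \<longlonglongrightarrow> h0 0"
    show ?thesis
    proof (rule integral_dominated_convergence[where w = "\<lambda>_. C"])
      show "AE w in M. (\<lambda>n. h n (Y n w)) \<longlonglongrightarrow> h0 (Y0 w)"
        using nonneg AE_space
      proof eventually_elim
        case (elim w)
        then show ?case using z conv[of "Y0 w" "\<lambda>n. Y n w"] lim[of w] by (cases "Y0 w = 0") auto
      qed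
    qed (use C in auto)
  next
    assume z: "h0 0 = 0 \<and> (\<forall>n v. v \<le> b n \<longrightarrow> h n v = 0) \<and> b \<longlonglongrightarrow> 0 \<and>
       (\<lambda>n. measure M {w \<in> space M. Y n w \<le> b n}) \<longlonglongrightarrow> measure M {w \<in> space M. Y0 w \<le> 0}"
    let ?p = "indicator {0<..} :: real \<Rightarrow> real"
    \<comment> \<open>On \<open>Y0 > 0\<close> continuous convergence applies; at
      \<open>Y0 = 0\<close> both sides are 0, since \<open>h0 0 = 0\<close>.\<close>
    have 1: "(\<lambda>n. \<integral>w. ?p (Y0 w) * h n (Y n w) \<partial>M) \<longlonglongrightarrow> (\<integral>w. h0 (Y0 w) \<partial>M)"
    proof (rule integral_dominated_convergence[where w = "\<lambda>_. C"])
      show "AE w in M. (\<lambda>n. ?p (Y0 w) * h n (Y n w)) \<longlonglongrightarrow> h0 (Y0 w)"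
        using nonneg AE_space
      proof eventually_elim
        case (elim w)
        then show ?case using z conv[of "Y0 w" "\<lambda>n. Y n w"] lim[of w] by (cases "Y0 w = 0") auto
      qed
      show "AE w in M. norm (?p (Y0 w) * h n (Y n w)) \<le> C" for n
        using C C0 by (auto simp: indicator_def)
    qed auto
    let ?m = "\<lambda>n. measure M {w \<in> space M. b n < Y n w \<and> Y0 w \<le> 0}"
    have "?m \<longlonglongrightarrow> 0" using z by (intro boundary_mass_vanishes[OF M Y lim]) auto
    then have m0: "(\<lambda>n. C * ?m n) \<longlonglongrightarrow> 0" by (rule tendsto_mult_right_zero)
    \<comment> \<open>Where \<open>Y0 \<le> 0\<close>, the integrand can be nonzero only if
      \<open>Y n\<close> exceeds \<open>b n\<close>, and it is at most \<open>C\<close> in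
      modulus.\<close>
    have bound: "\<bar>\<integral>w. (1 - ?p (Y0 w)) * h n (Y n w) \<partial>M\<bar> \<le> C * ?m n" for n
    proof -
      have "\<bar>\<integral>w. (1 - ?p (Y0 w)) * h n (Y n w) \<partial>M\<bar> \<le> (\<integral>w. \<bar>(1 - ?p (Y0 w)) * h n (Y n w)\<bar> \<partial>M)"
        by (rule integral_abs_bound)
      also have "\<dots> \<le> (\<integral>w. C * indicator {w \<in> space M. b n < Y n w \<and> Y0 w \<le> 0} w \<partial>M)"
      proof (rule integral_mono)
        show "integrable M (\<lambda>w. \<bar>(1 - ?p (Y0 w)) * h n (Y n w)\<bar>)"
          using C C0
          by (intro integrable_const_bound[of _ C] AE_I2) (auto simp: indicator_def)
        show "\<bar>(1 - ?p (Y0 w)) * h n (Y n w)\<bar> \<le> C * indicator {w \<in> space M. b n < Y n w \<and> Y0 w \<le> 0} w"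
          if "w \<in> space M" for w
          using that z C[of n "Y n w"] by (auto simp: indicator_def not_less)
      qed (auto intro!: integrable_mult_right integrable_real_indicator simp: emeasure_eq_measure simp del: integrable_mult_right_iff)
      also have "\<dots> = C * ?m n" by simp
      finally show ?thesis .
    qed
    have 2: "(\<lambda>n. \<integral>w. (1 - ?p (Y0 w)) * h n (Y n w) \<partial>M) \<longlonglongrightarrow> 0"
    proof (rule Lim_null_comparison[OF always_eventually m0], rule allI)
      show "norm (\<integral>w. (1 - ?p (Y0 w)) * h n (Y n w) \<partial>M) \<le> C * ?m n" for n
        unfolding real_norm_def by (rule bound)
    qed
    have "(\<integral>w. h n (Y n w) \<partial>M) = (\<integral>w. ?p (Y0 w) * h n (Y n w) \<partial>M) + (\<integral>w. (1 - ?p (Y0 w)) * h n (Y n w) \<partial>M)" for n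
      using C C0
      by (subst Bochner_Integration.integral_add[symmetric])
        (auto intro!: integrable_const_bound[of _ C] simp: indicator_def algebra_simps)
    then show ?thesis using tendsto_add[OF 1 2] by simp
  qed
qed

text \<open>Transfers the expectation limit from the representing variables to the kernel. The
  boundary condition translates because all laws live on \<open>[0,infinity)\<close>:
  \<open>Y n \<le> b n\<close> has the kernel mass of the scaled interval, and
  \<open>Y0 \<le> 0\<close> has mass \<open>measure G {0}\<close> as \<open>x0 > 0\<close>.\<close>

lemma kernel_integral_tendsto:
  fixes h :: "nat \<Rightarrow> real \<Rightarrow> real" and b :: "nat \<Rightarrow> real"
  assumes G: "prob_on halfline G" and K: "markov_kernel halfline K"
    and KG: "in_domain_of_attraction K G"
    and s: "\<And>n. 0 < s n" "filterlim s at_top sequentially"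
    and x: "\<And>n. 0 \<le> x n" "x \<longlonglongrightarrow> x0" "0 < x0"
    and h: "\<And>n. h n \<in> borel_measurable borel" "h0 \<in> borel_measurable borel"
    and C: "\<And>n v. \<bar>h n v\<bar> \<le> C"
    and conv: "\<And>v vs. 0 < v \<Longrightarrow> vs \<longlonglongrightarrow> v \<Longrightarrow> (\<lambda>n. h n (vs n)) \<longlonglongrightarrow> h0 v"
    and zero: "(\<forall>vs. vs \<longlonglongrightarrow> 0 \<longrightarrow> (\<lambda>n. h n (vs n)) \<longlonglongrightarrow> h0 0) \<or>
      (h0 0 = 0 \<and> (\<forall>n v. v \<le> b n \<longrightarrow> h n v = 0) \<and> b \<longlonglongrightarrow> 0 \<and>
       (\<lambda>n. measure (K (s n * x n)) ((*) (s n) ` {0..b n})) \<longlonglongrightarrow> measure G {0})"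
  shows "(\<lambda>n. \<integral>v. h n (v / s n) \<partial>K (s n * x n)) \<longlonglongrightarrow> (\<integral>v. h0 (x0 * v) \<partial>G)"
proof -
  have Gp: "prob_space G" "sets G = sets halfline" using G by (auto simp: prob_on_def)
  have Gs: "space G = {0..}" using sets_eq_imp_space_eq[OF Gp(2)] by simp
  have r0: "0 \<le> s n * x n" for n using s(1)[of n] x(1)[of n] by simp
  note Kr = markov_kernelD[OF K r0]
  note Km = borel_measurable_from_halfline[OF Kr(2)]
  note Gm = borel_measurable_from_halfline[OF Gp(2)]
  obtain \<Omega> :: "real measure" and Y Y0 where \<Omega>: "prob_space \<Omega>"
    and Y [measurable]: "\<And>n. Y n \<in> borel_measurable \<Omega>" "Y0 \<in> borel_measurable \<Omega>"
    and lim: "\<And>\<omega>. \<omega> \<in> space \<Omega> \<Longrightarrow> (\<lambda>n. Y n \<omega>) \<longlonglongrightarrow> Y0 \<omega>"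
    and dY: "\<forall>\<^sub>F n in sequentially. distr \<Omega> borel (Y n) = distr (K (s n * x n)) borel (\<lambda>v. v / s n)"
    and dY0: "distr \<Omega> borel Y0 = distr G borel (\<lambda>v. x0 * v)"
    using domain_of_attraction_representation[OF G K KG s x] by blast
  have div: "(\<lambda>v. v / s n) \<in> borel_measurable (K (s n * x n))" for n
    by (rule Km) measurable
  have mul: "(\<lambda>v. x0 * v) \<in> borel_measurable G"
    by (rule Gm) measurable
  have "AE v in distr G borel (\<lambda>v. x0 * v). 0 \<le> v"
    using mul Gs x(3) by (subst AE_distr_iff) auto
  then have "AE \<omega> in \<Omega>. 0 \<le> Y0 \<omega>"
    unfolding dY0[symmetric] by (subst (asm) AE_distr_iff) auto
  moreover have "(\<lambda>n. measure \<Omega> {w \<in> space \<Omega>. Y n w \<le> b n}) \<longlonglongrightarrow> measure \<Omega> {w \<in> space \<Omega>. Y0 w \<le> 0}"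
    if m: "(\<lambda>n. measure (K (s n * x n)) ((*) (s n) ` {0..b n})) \<longlonglongrightarrow> measure G {0}"
  proof -
    have "measure \<Omega> {w \<in> space \<Omega>. Y0 w \<le> 0} = measure (distr \<Omega> borel Y0) {..0}"
      by (subst measure_distr) (auto intro!: arg_cong[where f="measure \<Omega>"])
    also have "\<dots> = measure G {0}"
      unfolding dY0 using Gs x(3) mul
      by (subst measure_distr) (auto intro!: arg_cong[where f="measure G"] simp: mult_le_0_iff)
    finally have 0: "measure \<Omega> {w \<in> space \<Omega>. Y0 w \<le> 0} = measure G {0}" .
    have "\<forall>\<^sub>F n in sequentially. measure (K (s n * x n)) ((*) (s n) ` {0..b n}) = measure \<Omega> {w \<in> space \<Omega>. Y n w \<le> b n}"
      using dY
    proof eventually_elim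
      case (elim n)
      have eq: "(*) (s n) ` {0..b n} = {v. 0 \<le> v \<and> v / s n \<le> b n}"
      proof (intro equalityI subsetI)
        fix v assume v: "v \<in> {v. 0 \<le> v \<and> v / s n \<le> b n}"
        then have "v = s n * (v / s n)" "v / s n \<in> {0..b n}" using s(1)[of n] by auto
        then show "v \<in> (*) (s n) ` {0..b n}" by (rule image_eqI)
      qed (use s(1)[of n] in \<open>auto simp: field_simps\<close>)
      have "measure \<Omega> {w \<in> space \<Omega>. Y n w \<le> b n} = measure (distr \<Omega> borel (Y n)) {..b n}"
        by (subst measure_distr) (auto intro!: arg_cong[where f="measure \<Omega>"])
      also have "\<dots> = measure (K (s n * x n)) ((*) (s n) ` {0..b n})"
        unfolding elim eq using Kr(3) div
        by (subst measure_distr) (auto intro!: arg_cong[where f="measure (K (s n * x n))"])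
      finally show ?case ..
    qed
    then show ?thesis using Lim_transform_eventually[OF m] unfolding 0 by simp
  qed
  ultimately have "(\<lambda>n. \<integral>w. h n (Y n w) \<partial>\<Omega>) \<longlonglongrightarrow> (\<integral>w. h0 (Y0 w) \<partial>\<Omega>)"
    using zero by (intro expectation_tendsto_with_boundary[OF \<Omega> Y lim _ h C conv, where b = b]) auto
  moreover have "(\<integral>w. h0 (Y0 w) \<partial>\<Omega>) = (\<integral>v. h0 (x0 * v) \<partial>G)"
    using integral_distr[OF Y(2) h(2)] integral_distr[OF mul h(2)] dY0 by simp
  moreover have "\<forall>\<^sub>F n in sequentially. (\<integral>w. h n (Y n w) \<partial>\<Omega>) = (\<integral>v. h n (v / s n) \<partial>K (s n * x n))"
    using dY
  proof eventually_elim
    case (elim n)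
    then show ?case using integral_distr[OF Y(1)[of n] h(1)[of n]] integral_distr[OF div[of n] h(1)[of n]] by simp
  qed
  ultimately show ?thesis by (auto intro: Lim_transform_eventually)
qed

text \<open>Lets the iterated-integral formula apply to \<open>T\<close> too. Multiplication is
  jointly measurable, which gives the kernel off 0, and \<open>H\<close> is glued in at the
  measurable point 0.\<close>

lemma tail_kernel_markov_kernel:
  assumes G: "prob_on halfline G" and H: "prob_on halfline H"
  shows "markov_kernel halfline (tail_kernel G H)"
proof -
  have GH: "G \<in> space (prob_algebra halfline)" "H \<in> space (prob_algebra halfline)"
    using G H by (auto simp: prob_on_def space_prob_algebra)
  have "(\<lambda>p. fst p * snd p) \<in> halfline \<Otimes>\<^sub>M halfline \<rightarrow>\<^sub>M halfline"
  proof (rule measurable_halflineI)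
    have "fst \<in> borel_measurable (halfline \<Otimes>\<^sub>M halfline)" "snd \<in> borel_measurable (halfline \<Otimes>\<^sub>M halfline)"
      by (rule measurable_halflineD[OF measurable_fst], rule measurable_halflineD[OF measurable_snd])
    then show "(\<lambda>p. fst p * snd p) \<in> borel_measurable (halfline \<Otimes>\<^sub>M halfline)"
      by (rule borel_measurable_times)
  qed (auto simp: space_pair_measure)
  then have "(\<lambda>y. distr G halfline (\<lambda>x. y * x)) \<in> halfline \<rightarrow>\<^sub>M prob_algebra halfline"
    using GH by (intro measurable_distr_prob_space2[where M = halfline] measurable_const) (auto simp: case_prod_beta')
  moreover have "{y \<in> space halfline. y = 0} \<in> sets halfline"
    by (auto simp: sets_restrict_space_iff)
  ultimately show ?thesis
    unfolding tail_kernel_def[abs_def] using GH by (intro measurable_If measurable_const)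
qed

subsection \<open>Cut-off functionals of the path\<close>

abbreviation (input) to_cube :: "nat \<Rightarrow> (nat \<Rightarrow> real) \<Rightarrow> nat \<Rightarrow> ennreal" where
  "to_cube m z \<equiv> (\<lambda>i\<in>{1..m}. ennreal (z i))"

text \<open>The integrand behind both families of measures, pulled back to paths: the threshold
  \<open>c\<close> is \<open>y(t)\<close> before the limit and 0 in the limit.\<close>

definition cut_off :: "nat \<Rightarrow> ((nat \<Rightarrow> ennreal) \<Rightarrow> real) \<Rightarrow> real \<Rightarrow> (nat \<Rightarrow> real) \<Rightarrow> real" where
  "cut_off m f c z = indicator (E' m c) (to_cube m z) * f (to_cube m z)"

lemma to_cube_in_E':
  assumes "0 \<le> c"
  shows "to_cube m z \<in> E' m c \<longleftrightarrow> (\<forall>i. 1 \<le> i \<and> i < m \<longrightarrow> c < z i)"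
  unfolding E'_def PiE_iff using assms by (auto simp: ennreal_less_iff)

lemma cut_off_cong:
  assumes "\<And>i. i \<le> m \<Longrightarrow> z i = z' i"
  shows "cut_off m f c z = cut_off m f c z'"
proof -
  have "to_cube m z = to_cube m z'" using assms by (intro restrict_ext) simp
  then show ?thesis by (simp only: cut_off_def)
qed

lemma cut_off_eq_0:
  assumes "0 \<le> c" "1 \<le> i" "i < m" "z i \<le> c"
  shows "cut_off m f c z = 0"
proof -
  have "to_cube m z \<notin> E' m c" unfolding to_cube_in_E'[OF assms(1)] using assms(2-4) by (meson leD)
  then show ?thesis by (simp add: cut_off_def)
qed

lemma iter_exp_cut_off_eq_0:
  assumes "0 \<le> c" "1 \<le> i" "i < m" "i \<le> k" "z i \<le> c"
  shows "iter_exp K t (cut_off m f c) n k z = 0"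
  by (rule iter_exp_zero[where P = "\<lambda>a. a \<le> c" and i = i])
    (use assms in \<open>auto intro: cut_off_eq_0\<close>)

text \<open>Replaces the abstract topology on extensional functions by the topology of the type
  \<open>nat \<Rightarrow> ennreal\<close>, where the type-class results on continuity and Borel
  sets are available.\<close>

lemma continuous_on_cube_extension:
  assumes "continuous_map (cube_topology m) euclidean f"
  shows "continuous_on UNIV (\<lambda>g. f (restrict g {1..m}))"
proof -
  have "continuous_map (product_topology (\<lambda>_. euclidean) UNIV) (cube_topology m) (\<lambda>g. restrict g {1..m})"
    unfolding continuous_map_componentwise
    using continuous_map_product_projection[of _ UNIV "\<lambda>_. euclidean :: ennreal topology"] by auto
  from continuous_map_compose[OF this assms] show ?thesis
    by (simp add: euclidean_product_topology comp_def)
qed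

text \<open>Continuity yields Borel measurability on the full product type. Padding with 0 outside
  \<open>{1..m}\<close> is measurable from the product algebra coordinate by coordinate, and
  restricting afterwards recovers the original point.\<close>

lemma borel_measurable_cube:
  assumes "continuous_map (cube_topology m) euclidean (f :: _ \<Rightarrow> real)"
  shows "f \<in> borel_measurable (cube_borel m)"
proof -
  have "(\<lambda>x i. if i \<in> {1..m} then x i else 0) \<in> borel_measurable (cube_borel m)"
  proof (rule measurable_coordinatewise_then_product)
    show "(\<lambda>x. if i \<in> {1..m} then x i else 0) \<in> borel_measurable (cube_borel m)" for i
      by (cases "i \<in> {1..m}") auto
  qed
  then have "(\<lambda>x. f (restrict (\<lambda>i. if i \<in> {1..m} then x i else 0) {1..m})) \<in> borel_measurable (cube_borel m)"
    by (rule measurable_compose) (rule borel_measurable_continuous_onI[OF continuous_on_cube_extension[OF assms]])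
  moreover have "f x = f (restrict (\<lambda>i. if i \<in> {1..m} then x i else 0) {1..m})" if "x \<in> space (cube_borel m)" for x
    using that by (intro arg_cong[where f = f] ext) (auto simp: space_PiM PiE_iff extensional_def restrict_def)
  ultimately show ?thesis by (rule measurable_cong[THEN iffD2, rotated])
qed

text \<open>The cube is compact by Tychonoff, so \<open>f\<close> is bounded, and the same bound
  serves every threshold.\<close>

lemma cut_off_bounded:
  assumes "continuous_map (cube_topology m) euclidean (f :: _ \<Rightarrow> real)"
  obtains C where "\<And>c z. \<bar>cut_off m f c z\<bar> \<le> C"
proof -
  have "compact_space (cube_topology m)"
    by (simp add: compact_space_product_topology compact_space_def compactin_PiE Extended_Real_Limits.compact_UNIV)
  then have "compactin euclidean (f ` topspace (cube_topology m))"
    unfolding compact_space_def by (rule image_compactin) (rule assms)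
  then have "bounded (f ` topspace (cube_topology m))"
    by (simp add: compact_imp_bounded)
  then obtain C where "\<And>x. x \<in> topspace (cube_topology m) \<Longrightarrow> \<bar>f x\<bar> \<le> C"
    by (auto simp: bounded_iff)
  then have bound: "\<bar>f (to_cube m z)\<bar> \<le> C" for z by simp
  have "\<bar>cut_off m f c z\<bar> \<le> C" for c z
    using bound[of z] by (cases "to_cube m z \<in> E' m c") (simp_all add: cut_off_def)
  then show thesis by (rule that)
qed

lemma cut_off_measurable:
  assumes "f \<in> borel_measurable (cube_borel m)"
  shows "cut_off m f c \<in> borel_measurable paths"
proof -
  have c: "(\<lambda>z. z i) \<in> paths \<rightarrow>\<^sub>M halfline" for i by measurable
  have "to_cube m \<in> paths \<rightarrow>\<^sub>M cube_borel m"
    by (intro measurable_restrict measurable_compose[OF measurable_halflineD[OF c] measurable_ennreal])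
  moreover have "(\<lambda>x. indicator (E' m c) x * f x) \<in> borel_measurable (cube_borel m)"
    using assms sets_E'[of m c] by (intro borel_measurable_times borel_measurable_indicator)
  ultimately show ?thesis
    unfolding cut_off_def[abs_def] by (rule measurable_compose)
qed

text \<open>The coordinates below \<open>m\<close> have positive limits while the thresholds tend to
  0, so the indicator is eventually 1 and only the continuity of \<open>f\<close> remains.
  Coordinate \<open>m\<close> may tend to 0.\<close>

lemma cut_off_tendsto:
  assumes f: "continuous_map (cube_topology m) euclidean f"
    and z: "\<And>i. i \<le> m \<Longrightarrow> (\<lambda>n. \<zeta> n i) \<longlonglongrightarrow> z i" "\<And>i. i < m \<Longrightarrow> 0 < z i"
    and c: "\<And>n. 0 \<le> c n" "c \<longlonglongrightarrow> 0"
  shows "(\<lambda>n. cut_off m f (c n) (\<zeta> n)) \<longlonglongrightarrow> cut_off m f 0 z"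
proof -
  \<comment> \<open>Convergence is assumed only up to index \<open>m\<close>; setting the other
    coordinates to 0 gives convergence in the full product.\<close>
  let ?e = "\<lambda>z i. if i \<le> m then ennreal (z i) else 0"
  have e: "restrict (?e z) {1..m} = to_cube m z" for z by auto
  have "(\<lambda>n. ?e (\<zeta> n) i) \<longlonglongrightarrow> ?e z i" for i
    using z(1)[of i] by (cases "i \<le> m") (auto intro: tendsto_ennrealI)
  then have "limitin (product_topology (\<lambda>_. euclidean) UNIV) (\<lambda>n. ?e (\<zeta> n)) (?e z) sequentially"
    unfolding limitin_componentwise by simp
  then have "(\<lambda>n. ?e (\<zeta> n)) \<longlonglongrightarrow> ?e z"
    by (simp only: euclidean_product_topology limitin_canonical_iff)
  then have "(\<lambda>n. f (restrict (?e (\<zeta> n)) {1..m})) \<longlonglongrightarrow> f (restrict (?e z) {1..m})"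
    by (intro continuous_on_tendsto_compose[OF continuous_on_cube_extension[OF f]]) auto
  then have "(\<lambda>n. f (to_cube m (\<zeta> n))) \<longlonglongrightarrow> f (to_cube m z)" by (simp only: e)
  moreover have "\<forall>\<^sub>F n in sequentially. f (to_cube m (\<zeta> n)) = cut_off m f (c n) (\<zeta> n)"
  proof -
    have "\<forall>\<^sub>F n in sequentially. \<forall>i\<in>{..<m}. 0 < \<zeta> n i - c n"
    proof (intro eventually_ball_finite ballI)
      fix i assume "i \<in> {..<m}"
      then have "(\<lambda>n. \<zeta> n i - c n) \<longlonglongrightarrow> z i - 0" "0 < z i - 0"
        using tendsto_diff[OF z(1) c(2), of i] z(2)[of i] by simp_all
      then show "\<forall>\<^sub>F n in sequentially. 0 < \<zeta> n i - c n" by (rule order_tendstoD)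
    qed simp
    then show ?thesis
    proof eventually_elim
      case (elim n)
      then have "to_cube m (\<zeta> n) \<in> E' m (c n)" unfolding to_cube_in_E'[OF c(1)] by auto
      then show ?case by (simp add: cut_off_def)
    qed
  qed
  moreover have "f (to_cube m z) = cut_off m f 0 z"
  proof -
    have "to_cube m z \<in> E' m 0" unfolding to_cube_in_E'[OF order_refl] using z(2) by blast
    then show ?thesis by (simp add: cut_off_def)
  qed
  ultimately show ?thesis by (auto intro: Lim_transform_eventually)
qed

section \<open>Continuous convergence of the iterated integrals and conclusion\<close>

lemma integral_law_on_E':
  assumes f: "f \<in> borel_measurable (cube_borel m)" and Z: "\<And>i. Z i \<in> borel_measurable M"
  shows "(\<integral>x. f x \<partial>law_on M (cube_borel m) (\<lambda>w. to_cube m (\<lambda>i. Z i w)) (E' m c)) =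
    (\<integral>w. cut_off m f c (\<lambda>i. Z i w) \<partial>M)"
proof -
  have V: "(\<lambda>w. to_cube m (\<lambda>i. Z i w)) \<in> M \<rightarrow>\<^sub>M cube_borel m"
    by (intro measurable_restrict measurable_compose[OF Z measurable_ennreal])
  have E: "(\<lambda>x. indicator (E' m c) x :: real) \<in> borel_measurable (cube_borel m)"
    using sets_E' by (rule borel_measurable_indicator)
  have "law_on M (cube_borel m) (\<lambda>w. to_cube m (\<lambda>i. Z i w)) (E' m c) =
      density (distr M (cube_borel m) (\<lambda>w. to_cube m (\<lambda>i. Z i w))) (\<lambda>x. ennreal (indicator (E' m c) x))"
    unfolding law_on_def by (intro arg_cong2[where f = density]) (auto simp: indicator_def)
  also have "integral\<^sup>L \<dots> f = (\<integral>x. indicator (E' m c) x *\<^sub>R f x \<partial>distr M (cube_borel m) (\<lambda>w. to_cube m (\<lambda>i. Z i w)))"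
    using f E by (intro integral_density) auto
  also have "\<dots> = (\<integral>w. cut_off m f c (\<lambda>i. Z i w) \<partial>M)"
    unfolding cut_off_def using f E by (subst integral_distr[OF V]) auto
  finally show ?thesis .
qed

text \<open>The paths \<zeta> must move with \<open>j\<close>: the outer integral needs convergence
  of the inner one along arbitrary convergent states. Positive limits are demanded only below index
  \<open>m\<close>, so at the innermost level the new state may tend to 0.\<close>

lemma iter_exp_tendsto:
  fixes \<zeta> :: "nat \<Rightarrow> nat \<Rightarrow> real" and z :: "nat \<Rightarrow> real" and s :: "nat \<Rightarrow> real"
  assumes G: "prob_on halfline G" and H: "prob_on halfline H" and K: "markov_kernel halfline K"
    and KG: "in_domain_of_attraction K G"
    and y: "uniform_extremal_boundary K G y"
    and y_nonneg: "\<And>j. 0 \<le> y (s j)" and y_lim: "(\<lambda>j. y (s j)) \<longlonglongrightarrow> 0"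
    and s: "\<And>n. 0 < s n" "filterlim s at_top sequentially"
    and f: "continuous_map (cube_topology m) euclidean f"
  shows "n + k = m \<Longrightarrow> (\<And>j i. 0 \<le> \<zeta> j i) \<Longrightarrow> (\<And>i. 0 \<le> z i) \<Longrightarrow>
    (\<And>i. i \<le> k \<Longrightarrow> (\<lambda>j. \<zeta> j i) \<longlonglongrightarrow> z i) \<Longrightarrow> (\<And>i. i \<le> k \<Longrightarrow> i < m \<Longrightarrow> 0 < z i) \<Longrightarrow>
    (\<lambda>j. iter_exp K (s j) (cut_off m f (y (s j))) n k (\<zeta> j)) \<longlonglongrightarrow>
      iter_exp (tail_kernel G H) 1 (cut_off m f 0) n k z"
proof (induction n arbitrary: k \<zeta> z)
  case 0
  have "(\<lambda>j. cut_off m f (y (s j)) (\<zeta> j)) \<longlonglongrightarrow> cut_off m f 0 z"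
    by (rule cut_off_tendsto[OF f _ _ y_nonneg y_lim]) (use 0 in simp_all)
  then show ?case by simp
next
  case (Suc n)
  let ?T = "tail_kernel G H"
  let ?J = "\<lambda>j. iter_exp K (s j) (cut_off m f (y (s j))) n (Suc k)"
  let ?L = "iter_exp ?T 1 (cut_off m f 0) n (Suc k)"
  have zk: "0 < z k" using Suc.prems(1,5) by simp
  have T: "markov_kernel halfline ?T" using G H by (rule tail_kernel_markov_kernel)
  have Gp: "prob_space G" "sets G = sets halfline" "space G = {0..}"
    using G sets_eq_imp_space_eq[of G halfline] by (auto simp: prob_on_def)
  have fm: "f \<in> borel_measurable (cube_borel m)" using f by (rule borel_measurable_cube)
  obtain C where C: "\<And>c z. \<bar>cut_off m f c z\<bar> \<le> C" using cut_off_bounded[OF f] by blast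
  \<comment> \<open>Clipping at 0 extends the inner integrals to the whole real line, since the
    approximating sequences \<open>vs\<close> may take negative values.\<close>
  define h where "h j v = ?J j ((\<zeta> j)(Suc k := max 0 v))" for j v
  define h0 where "h0 v = ?L (z(Suc k := max 0 v))" for v
  have upd: "(\<lambda>v. w(Suc k := max 0 v)) \<in> borel \<rightarrow>\<^sub>M paths" if "\<And>i. 0 \<le> w i" for w :: "nat \<Rightarrow> real"
  proof (rule measurable_PiM_single')
    fix i :: nat
    show "(\<lambda>v. (w(Suc k := max 0 v)) i) \<in> borel \<rightarrow>\<^sub>M halfline"
      using that by (cases "i = Suc k") (auto intro!: measurable_halflineI)
  qed (use that in \<open>auto simp: PiE_iff\<close>)
  have h: "h j \<in> borel_measurable borel" for j
    unfolding h_def[abs_def] using Suc.prems(2) s(1)[of j]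
    by (intro measurable_compose[OF upd iter_exp_measurable[OF K cut_off_measurable[OF fm]]]) auto
  have h0: "h0 \<in> borel_measurable borel"
    unfolding h0_def[abs_def] using Suc.prems(3)
    by (intro measurable_compose[OF upd iter_exp_measurable[OF T cut_off_measurable[OF fm]]]) auto
  have hC: "\<bar>h j v\<bar> \<le> C" for j v
    unfolding h_def using s(1)[of j] Suc.prems(2)
    by (intro iter_exp_bound[OF K _ C]) (auto simp: space_paths)
  \<comment> \<open>If \<open>n = 0\<close>, the state just added has index \<open>m\<close>, so the
    induction hypothesis also covers the limit 0.\<close>
  have step: "(\<lambda>j. h j (vs j)) \<longlonglongrightarrow> h0 v" if "vs \<longlonglongrightarrow> v" "0 < v \<or> (v = 0 \<and> n = 0)" for vs v
    unfolding h_def h0_def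
  proof (rule Suc.IH)
    show "(\<lambda>j. ((\<zeta> j)(Suc k := max 0 (vs j))) i) \<longlonglongrightarrow> (z(Suc k := max 0 v)) i" if "i \<le> Suc k" for i
      using that Suc.prems(4)[of i] \<open>vs \<longlonglongrightarrow> v\<close> by (auto intro!: tendsto_max)
    show "0 < (z(Suc k := max 0 v)) i" if "i \<le> Suc k" "i < m" for i
      using that Suc.prems(1,5) \<open>0 < v \<or> (v = 0 \<and> n = 0)\<close> by (auto simp: le_Suc_eq)
  qed (use Suc.prems(1-3) in auto)
  have "(\<lambda>j. \<integral>v. h j (v / s j) \<partial>K (s j * \<zeta> j k)) \<longlonglongrightarrow> (\<integral>v. h0 (z k * v) \<partial>G)"
  proof (rule kernel_integral_tendsto[OF G K KG s _ _ zk h h0 hC, where b = "\<lambda>j. y (s j)"])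
    show "(\<forall>vs. vs \<longlonglongrightarrow> 0 \<longrightarrow> (\<lambda>j. h j (vs j)) \<longlonglongrightarrow> h0 0) \<or>
      (h0 0 = 0 \<and> (\<forall>j v. v \<le> y (s j) \<longrightarrow> h j v = 0) \<and> (\<lambda>j. y (s j)) \<longlonglongrightarrow> 0 \<and>
       (\<lambda>j. measure (K (s j * \<zeta> j k)) ((*) (s j) ` {0..y (s j)})) \<longlonglongrightarrow> measure G {0})"
    \<comment> \<open>At the last coordinate continuous convergence holds at 0 too. At an earlier
      one the cut-off makes \<open>h j\<close> vanish up to \<open>y (s j)\<close>, and the uniform
      boundary property supplies the mass condition.\<close>
    proof (cases "n = 0")
      case True
      then show ?thesis using step[of _ 0] by simp
    next
      case False
      then have k: "Suc k < m" using Suc.prems(1) by simp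
      have "(\<lambda>j. measure (K (s j * \<zeta> j k)) ((*) (s j) ` {0..y (s j)})) \<longlonglongrightarrow> measure G {0}"
      proof (rule uniform_limit_along_sequence[OF _ s(2), where x = "\<lambda>j. \<zeta> j k" and a = "z k"
          and g = "\<lambda>t v. measure (K (t * v)) ((*) t ` {0..y t})"])
        show "((\<lambda>t. measure (K (t * u t)) ((*) t ` {0..y t})) \<longlongrightarrow> measure G {0}) at_top"
          if "\<forall>t\<ge>0. 0 \<le> u t" "(u \<longlongrightarrow> z k) at_top" for u
          using y zk that unfolding uniform_extremal_boundary_def by blast
      qed (use Suc.prems(2) Suc.prems(4)[OF order_refl] in auto)
      moreover have "h j v = 0" if "v \<le> y (s j)" for j v
        unfolding h_def
        by (rule iter_exp_cut_off_eq_0[where i = "Suc k"]) (use k that y_nonneg[of j] in simp_all)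
      moreover have "h0 0 = 0"
        unfolding h0_def
        by (rule iter_exp_cut_off_eq_0[where i = "Suc k"]) (use k in simp_all)
      ultimately show ?thesis using y_lim by blast
    qed
  qed (use Suc.prems(2) Suc.prems(4)[OF order_refl] step in auto)
  moreover have "(\<integral>v. h j (v / s j) \<partial>K (s j * \<zeta> j k)) = iter_exp K (s j) (cut_off m f (y (s j))) (Suc n) k (\<zeta> j)" for j
  proof -
    have "0 \<le> s j * \<zeta> j k" using s(1)[of j] Suc.prems(2)[of j k] by simp
    from markov_kernelD(3)[OF K this] show ?thesis
      using s(1)[of j] by (auto simp: h_def max_def intro!: Bochner_Integration.integral_cong)
  qed
  moreover have "(\<integral>v. h0 (z k * v) \<partial>G) = iter_exp ?T 1 (cut_off m f 0) (Suc n) k z"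
  proof -
    have Gm: "(\<lambda>v. z k * v) \<in> G \<rightarrow>\<^sub>M halfline"
      using zk Gp(3) by (intro measurable_halflineI borel_measurable_from_halfline[OF Gp(2)]) auto
    have "iter_exp ?T 1 (cut_off m f 0) (Suc n) k z = (\<integral>v. h0 v \<partial>?T (z k))"
      using markov_kernelD(3)[OF T, of "z k"] zk
      by (auto simp: h0_def max_def intro!: Bochner_Integration.integral_cong)
    also have "\<dots> = (\<integral>v. h0 v \<partial>distr G halfline (\<lambda>v. z k * v))"
      using zk by (simp add: tail_kernel_def)
    also have "\<dots> = (\<integral>v. h0 (z k * v) \<partial>G)"
      using Gm measurable_restrict_space1[OF h0] by (rule integral_distr)
    finally show ?thesis ..
  qed
  ultimately show ?case by (simp only:)
qed

theorem theorem3p2: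
  fixes G H :: "real measure"
    and K :: "real \<Rightarrow> real measure"
    and P :: "real \<Rightarrow> 'a measure" and X :: "nat \<Rightarrow> 'a \<Rightarrow> real"
    and Q :: "real \<Rightarrow> 'b measure" and T :: "nat \<Rightarrow> 'b \<Rightarrow> real"
    and y u :: "real \<Rightarrow> real" and u0 :: real and m :: nat
  assumes G: "prob_on halfline G"
    and K: "markov_kernel halfline K"
    and K_G: "in_domain_of_attraction K G"
    and X: "markov_family halfline K P X"
    and y: "uniform_extremal_boundary K G y"
    and H: "prob_on halfline H"
    and T: "markov_family halfline (tail_kernel G H) Q T"
    and m: "1 \<le> m"
    and u_nonneg: "\<And>t. 0 \<le> t \<Longrightarrow> 0 \<le> u t"
    and u_lim: "(u \<longlongrightarrow> u0) at_top"
    and u_pos: "0 < u0"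
  shows "vague_conv_in (cube_topology m)
           (\<lambda>t. mu_tilde P X y m t (u t)) (mu Q T m u0) at_top"
  unfolding vague_conv_in_def
proof (intro allI impI tendsto_at_top_positive_sequencesI)
  fix f :: "(nat \<Rightarrow> ennreal) \<Rightarrow> real" and s :: "nat \<Rightarrow> real"
  assume f: "continuous_map (cube_topology m) euclidean f"
    and s: "\<And>n. 0 < s n" "filterlim s at_top sequentially"
  have fm: "f \<in> borel_measurable (cube_borel m)" using f by (rule borel_measurable_cube)
  note TK = tail_kernel_markov_kernel[OF G H]
  obtain C where C: "\<And>c z. \<bar>cut_off m f c z\<bar> \<le> C" using cut_off_bounded[OF f] by blast
  have chain_measurable: "Z i \<in> borel_measurable (R x)" if "markov_family halfline N R Z" "0 \<le> x"
    for N and R :: "real \<Rightarrow> 'c measure" and Z :: "nat \<Rightarrow> 'c \<Rightarrow> real" and i x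
    using that by (intro measurable_halflineD) (simp add: markov_family_def markov_chain_def)
  have y_nonneg: "0 \<le> y (s n)" for n
    using y s(1)[of n] by (simp add: uniform_extremal_boundary_def extremal_boundary_def)
  have y_lim: "(\<lambda>n. y (s n)) \<longlonglongrightarrow> 0"
    using y unfolding uniform_extremal_boundary_def extremal_boundary_def
    by (blast intro: filterlim_compose[OF _ s(2)])
  have u: "0 \<le> u (s n)" for n using u_nonneg s(1)[of n] by simp
  have "(\<integral>x. f x \<partial>mu_tilde P X y m (s n) (u (s n))) =
      iter_exp K (s n) (cut_off m f (y (s n))) m 0 (\<lambda>_. u (s n))" for n
  proof -
    have "0 \<le> s n * u (s n)" using s(1)[of n] u[of n] by simp
    then have "(\<lambda>w. X i w / s n) \<in> borel_measurable (P (s n * u (s n)))" for i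
      using chain_measurable[OF X] by (intro borel_measurable_divide measurable_const) auto
    then have "(\<integral>x. f x \<partial>mu_tilde P X y m (s n) (u (s n))) =
        (\<integral>w. cut_off m f (y (s n)) (\<lambda>i. X i w / s n) \<partial>P (s n * u (s n)))"
      unfolding mu_tilde_def by (rule integral_law_on_E'[OF fm])
    also have "\<dots> = iter_exp K (s n) (cut_off m f (y (s n))) m 0 (\<lambda>_. u (s n))"
      by (rule markov_family_iter_exp[OF X K cut_off_measurable[OF fm] s(1) u C cut_off_cong])
    finally show ?thesis .
  qed
  moreover have "(\<integral>x. f x \<partial>mu Q T m u0) = iter_exp (tail_kernel G H) 1 (cut_off m f 0) m 0 (\<lambda>_. u0)"
  proof -
    have "(\<integral>x. f x \<partial>mu Q T m u0) = (\<integral>w. cut_off m f 0 (\<lambda>i. T i w) \<partial>Q u0)"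
      unfolding mu_def using chain_measurable[OF T] u_pos by (intro integral_law_on_E'[OF fm]) auto
    \<comment> \<open>The limit chain needs no rescaling: it is the iterated formula at scale
      \<open>t = 1\<close>.\<close>
    also have "\<dots> = iter_exp (tail_kernel G H) 1 (cut_off m f 0) m 0 (\<lambda>_. u0)"
      using markov_family_iter_exp[OF T TK cut_off_measurable[OF fm] zero_less_one less_imp_le[OF u_pos] C cut_off_cong]
      by simp
    finally show ?thesis .
  qed
  \<comment> \<open>With \<open>k = 0\<close> only the initial coordinate has to converge to a
    positive limit, which is the assumption on \<open>u\<close>.\<close>
  moreover have "(\<lambda>n. iter_exp K (s n) (cut_off m f (y (s n))) m 0 (\<lambda>_. u (s n))) \<longlonglongrightarrow>
      iter_exp (tail_kernel G H) 1 (cut_off m f 0) m 0 (\<lambda>_. u0)"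
    using u u_pos filterlim_compose[OF u_lim s(2)]
    by (intro iter_exp_tendsto[OF G H K K_G y y_nonneg y_lim s f]) auto
  ultimately show "(\<lambda>n. \<integral>x. f x \<partial>mu_tilde P X y m (s n) (u (s n))) \<longlonglongrightarrow> (\<integral>x. f x \<partial>mu Q T m u0)"
    by simp
qed

end
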